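(* Let $\mathcal I=[0,b)$, $X$, $d_n$ with $\sup_nd_n<\infty$, $\alpha=\{\alpha_n\}_{n=1}^\infty\subset\mathbb R$ and $\mathrm H_{X,\alpha}$ be as in the context. Let $B_{X,\alpha}$ be the minimal Jacobi operator in $l_2(\mathbb N)$ associated with the symmetric tridiagonal matrix with diagonal entries $r_n^{-2}\bigl(\alpha_n+\frac1{d_n}+\frac1{d_{n+1}}\bigr)$ and off-diagonal entries (positions $(n,n+1)$ and $(n+1,n)$) $-(r_nr_{n+1}d_{n+1})^{-1}$, where $r_n=\sqrt{d_n+d_{n+1}}$, $n\in\mathbb N$. Then the operator $\mathrm H_{X,\alpha}$ is lower semibounded if and only if $B_{X,\alpha}$ is lower semibounded.
   Context: Let $\mathcal I=[0,b)$, $0<b\le+\infty$, and $X=\{x_n\}_{n=1}^\infty$, $x_0=0$, with $0=x_0<x_1<x_2<\dots<b$ and $\lim_nx_n=b$; $d_n=x_n-x_{n-1}$, and $d^*=\sup_nd_n<\infty$ is assumed. $W^{2,2}(\mathcal I\setminus X)=\{f\in L^2(\mathcal I): f,f'\in AC_{loc}(\mathcal I\setminus X),\ f''\in L^2(\mathcal I)\}$, and $W^{2,2}_{\mathrm{comp}}(\mathcal I\setminus X)$ is the set of its elements whose support is compact in $\mathcal I=[0,b)$. $\mathrm H_{X,\alpha}$ is the closure in $L^2(\mathcal I)$ of the symmetric operator $-\mathrm d^2/\mathrm dx^2$ with domain $$\{f\in W^{2,2}_{\mathrm{comp}}(\mathcal I\setminus X): f'(0)=0,\ f(x_n+)=f(x_n-),\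 f'(x_n+)-f'(x_n-)=\alpha_nf(x_n),\ n\in\mathbb N\}.$$ The minimal operator associated with a Jacobi matrix is the closure in $l_2(\mathbb N)$ of the operator defined by the matrix on finitely supported sequences. A symmetric operator $T$ is lower semibounded if $(Tf,f)\ge c\|f\|^2$ for all $f\in\operatorname{dom}(T)$ with some $c\in\mathbb R$. *)

theory Defs
  imports "HOL-Analysis.Analysis"
begin

section \<open>Unbounded operators in an \<open>L\<^sup>2\<close> space\<close>

text \<open>
  Elements of \<open>L\<^sup>2(M)\<close> are handled through their representatives, i.e. square integrable
  functions; only integrals over \<open>M\<close> are ever taken of them. With \<open>M = lebesgue_on I\<close> this is
  \<open>L\<^sup>2(I)\<close>, with \<open>M = count_space {1..}\<close> it is \<open>l\<^sub>2\<close> over the positive integers.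
  A linear operator is represented by its graph.
\<close>

definition L2_space :: "'a measure \<Rightarrow> ('a \<Rightarrow> complex) set" where
  "L2_space M = {f. f \<in> borel_measurable M \<and> integrable M (\<lambda>t. (cmod (f t))\<^sup>2)}"

definition L2_inner :: "'a measure \<Rightarrow> ('a \<Rightarrow> complex) \<Rightarrow> ('a \<Rightarrow> complex) \<Rightarrow> complex" where
  "L2_inner M f g = (LINT t|M. f t * cnj (g t))"

definition L2_norm :: "'a measure \<Rightarrow> ('a \<Rightarrow> complex) \<Rightarrow> real" where
  "L2_norm M f = sqrt (LINT t|M. (cmod (f t))\<^sup>2)"

type_synonym 'a op_graph = "(('a \<Rightarrow> complex) \<times> ('a \<Rightarrow> complex)) set"

definition op_closure :: "'a measure \<Rightarrow> 'a op_graph \<Rightarrow> 'a op_graph" where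
  "op_closure M T = {(f, g). f \<in> L2_space M \<and> g \<in> L2_space M \<and>
     (\<exists>F G. (\<forall>k::nat. (F k, G k) \<in> T) \<and>
        (\<lambda>k. L2_norm M (\<lambda>t. F k t - f t)) \<longlonglongrightarrow> 0 \<and>
        (\<lambda>k. L2_norm M (\<lambda>t. G k t - g t)) \<longlonglongrightarrow> 0)}"

definition lower_semibounded :: "'a measure \<Rightarrow> 'a op_graph \<Rightarrow> bool" where
  "lower_semibounded M T \<longleftrightarrow> (\<exists>c::real. \<forall>(f, g) \<in> T.
     L2_inner M g f \<in> \<real> \<and> Re (L2_inner M g f) \<ge> c * (L2_norm M f)\<^sup>2)"


section \<open>The operator \<open>H\<^bsub>X,\<alpha>\<^esub>\<close>\<close>

definition AC_on :: "real \<Rightarrow> real \<Rightarrow> (real \<Rightarrow> complex) \<Rightarrow> bool" where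
  "AC_on a c f \<longleftrightarrow> (\<forall>\<epsilon>>0. \<exists>\<delta>>0. \<forall>P::(real \<times> real) set.
     finite P \<longrightarrow> (\<forall>(u, v) \<in> P. a \<le> u \<and> u \<le> v \<and> v \<le> c) \<longrightarrow>
     disjoint_family_on (\<lambda>(u, v). {u<..<v}) P \<longrightarrow>
     (\<Sum>(u, v)\<in>P. v - u) < \<delta> \<longrightarrow> (\<Sum>(u, v)\<in>P. cmod (f v - f u)) < \<epsilon>)"

definition AC_loc :: "real set \<Rightarrow> (real \<Rightarrow> complex) \<Rightarrow> bool" where
  "AC_loc S f \<longleftrightarrow> (\<forall>a c. a \<le> c \<longrightarrow> {a..c} \<subseteq> S \<longrightarrow> AC_on a c f)"

definition deriv_within :: "real set \<Rightarrow> (real \<Rightarrow> complex) \<Rightarrow> real \<Rightarrow> complex" where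
  "deriv_within S f t = vector_derivative f (at t within S)"

text \<open>
  As \<open>f'\<close> is required to be locally absolutely continuous, \<open>f\<close> is continuously differentiable on
  \<open>I - X\<close> (one-sidedly at \<open>0\<close>), while \<open>f''\<close> exists almost everywhere. Both facts are
  listed because \<^const>\<open>vector_derivative\<close> is unspecified where the derivative does not exist.
\<close>

definition W22 :: "real set \<Rightarrow> real set \<Rightarrow> (real \<Rightarrow> complex) set" where
  "W22 I X = {f. let f' = deriv_within (I - X) f; f'' = deriv_within (I - X) f' in
     f \<in> L2_space (lebesgue_on I) \<and>
     AC_loc (I - X) f \<and> f differentiable_on (I - X) \<and>
     AC_loc (I - X) f' \<and> (AE t in lebesgue_on I. f' differentiable (at t within I - X)) \<and>
     f'' \<in> L2_space (lebesgue_on I)}"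

text \<open>
  Elements of \<^term>\<open>W22 I X\<close> are continuous on \<open>I - X\<close>, and their values on the null set \<open>X\<close> are
  irrelevant, so the support is the closure in \<open>I\<close> of the following set.
\<close>

definition W22_comp :: "real set \<Rightarrow> real set \<Rightarrow> (real \<Rightarrow> complex) set" where
  "W22_comp I X = {f \<in> W22 I X. compact (I \<inter> closure {t \<in> I - X. f t \<noteq> 0})}"

definition half_open :: "ereal \<Rightarrow> real set" where
  "half_open b = {t. 0 \<le> t \<and> ereal t < b}"

text \<open>
  Below, \<open>v\<close> is the common value of \<open>f(x\<^sub>n+)\<close> and \<open>f(x\<^sub>n-)\<close>, which is what \<open>f(x\<^sub>n)\<close> means, and
  \<open>p\<close>, \<open>q\<close> are \<open>f'(x\<^sub>n+)\<close>, \<open>f'(x\<^sub>n-)\<close>. The points of \<open>X\<close> are \<open>x 1, x 2, \<dots>\<close>, without \<open>x 0 = 0\<close>.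
\<close>

definition H_dom :: "ereal \<Rightarrow> (nat \<Rightarrow> real) \<Rightarrow> (nat \<Rightarrow> real) \<Rightarrow> (real \<Rightarrow> complex) set" where
  "H_dom b x \<alpha> = (let I = half_open b; X = x ` {1..} in
     {f \<in> W22_comp I X. let f' = deriv_within (I - X) f in
        f' 0 = 0 \<and>
        (\<forall>n\<ge>1. \<exists>v p q.
           (f \<longlongrightarrow> v) (at_right (x n)) \<and> (f \<longlongrightarrow> v) (at_left (x n)) \<and>
           (f' \<longlongrightarrow> p) (at_right (x n)) \<and> (f' \<longlongrightarrow> q) (at_left (x n)) \<and>
           p - q = complex_of_real (\<alpha> n) * v)})"

definition H_op :: "ereal \<Rightarrow> (nat \<Rightarrow> real) \<Rightarrow> (nat \<Rightarrow> real) \<Rightarrow> real op_graph" where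
  "H_op b x \<alpha> = (let I = half_open b; X = x ` {1..} in
     op_closure (lebesgue_on I)
       {(f, \<lambda>t. - deriv_within (I - X) (deriv_within (I - X) f) t) | f. f \<in> H_dom b x \<alpha>})"


section \<open>Minimal Jacobi operators\<close>

text \<open>The sequences \<open>a\<close> and \<open>c\<close> are the diagonal and the off-diagonal; indices start at \<open>1\<close>.\<close>

definition jacobi_matrix :: "(nat \<Rightarrow> real) \<Rightarrow> (nat \<Rightarrow> real) \<Rightarrow> nat \<Rightarrow> nat \<Rightarrow> real" where
  "jacobi_matrix a c i j =
     (if j = i then a i else if j = i + 1 then c i else if i = j + 1 then c j else 0)"

definition min_jacobi_op :: "(nat \<Rightarrow> real) \<Rightarrow> (nat \<Rightarrow> real) \<Rightarrow> nat op_graph" where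
  "min_jacobi_op a c = op_closure (count_space {1..})
     {(u, \<lambda>i. \<Sum>j | u j \<noteq> 0. complex_of_real (jacobi_matrix a c i j) * u j) | u.
        finite {j. u j \<noteq> 0} \<and> {j. u j \<noteq> 0} \<subseteq> {1..}}"

end

(*
  Both operators are semibounded iff their quadratic forms on cores are. On the core,
  (H f, f) = sum_n int |f'|^2 + sum_n alpha_n |f(x_n)|^2, while (B u, u) with u_n = r_n y_n, y_0 = 0 is
  the form sum_n |y_(n+1) - y_n|^2 / d_(n+1) + sum_n alpha_n |y_n|^2, and |u|^2 is the sum of
  d_(n+1) (|y_n|^2 + |y_(n+1)|^2).  The forms are compared interval by interval: the energy of f on an
  interval exceeds that of its affine interpolant by any multiple of d (|f(u)|^2 + |f(v)|^2), at the cost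
  of a multiple of int |f|^2 which is uniform for bounded d; conversely, affine interpolants are limits
  in H^1 of functions from the domain.  The first interval, where f' instead of f vanishes at 0,
  contributes only a bounded perturbation.
*)

theory Submission
  imports Defs
begin

section \<open>The Hilbert space and closures of operators\<close>

text \<open>The pivot is \<open>graph_form_bounded\<close>, a statement about finite sequences
  without operator domains; \<open>r\<close> is merely the weight that turns the mass into the plain
  square-sum norm. The lengths d_n may tend to 0, and then the sum of |f(x_n)|^2 is not controlled
  by the H^1 norm of f; only the sum weighted with the d_n is. A multiplier linear on each interval,
  with end values of order d_n, produces exactly this weight. Replacing f(0) by 0 on the first
  interval costs at most |y_1|^2 / d_1, which is the fixed number 1 / d_1^2 times a piece of the
  mass. An affine interpolant is usually not in the domain: the values y dictate its slopes, while
  f' must jump by \<alpha>_n y_n. The slopes are therefore corrected near the nodes by functions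
  that vanish in H^1. All right end slopes are made 0 and the whole jump is put into the left end
  slope, so that the intervals can be treated independently. Since f'' exists only almost
  everywhere, integration by parts needs the fundamental theorem for absolutely continuous
  functions, proved here directly with gauges.\<close>

lemma L2_spaceD:
  assumes "f \<in> L2_space M"
  shows "f \<in> borel_measurable M" "integrable M (\<lambda>t. (cmod (f t))\<^sup>2)"
  using assms by (auto simp: L2_space_def)

lemma L2_norm_nonneg [simp]: "0 \<le> L2_norm M f"
  by (simp add: L2_norm_def)

lemma L2_norm_power2: "(L2_norm M f)\<^sup>2 = (LINT t|M. (cmod (f t))\<^sup>2)"
  by (simp add: L2_norm_def)

lemma L2_space_diff:
  assumes f: "f \<in> L2_space M" and g: "g \<in> L2_space M"
  shows "(\<lambda>t. f t - g t) \<in> L2_space M"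
proof -
  note [measurable] = L2_spaceD(1)[OF f] L2_spaceD(1)[OF g]
  have "integrable M (\<lambda>t. 2 * (cmod (f t))\<^sup>2 + 2 * (cmod (g t))\<^sup>2)"
    using f g by (intro Bochner_Integration.integrable_add Bochner_Integration.integrable_mult_right L2_spaceD(2)) auto
  then have "integrable M (\<lambda>t. (cmod (f t - g t))\<^sup>2)"
  proof (rule Bochner_Integration.integrable_bound)
    have "(cmod (z - w))\<^sup>2 \<le> 2 * (cmod z)\<^sup>2 + 2 * (cmod w)\<^sup>2" for z w
    proof -
      have "(cmod (z - w))\<^sup>2 \<le> (cmod z + cmod w)\<^sup>2"
        by (intro power_mono norm_triangle_ineq4) auto
      also have "\<dots> \<le> 2 * (cmod z)\<^sup>2 + 2 * (cmod w)\<^sup>2"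
        using zero_le_power2[of "cmod z - cmod w"] by (simp add: power2_eq_square algebra_simps)
      finally show ?thesis .
    qed
    then show "AE t in M. norm ((cmod (f t - g t))\<^sup>2) \<le> norm (2 * (cmod (f t))\<^sup>2 + 2 * (cmod (g t))\<^sup>2)"
      by simp
  qed measurable
  then show ?thesis
    by (simp add: L2_space_def)
qed

lemma integrable_L2_mult:
  assumes f: "f \<in> L2_space M" and g: "g \<in> L2_space M"
  shows "integrable M (\<lambda>t. f t * cnj (g t))"
proof -
  note [measurable] = L2_spaceD(1)[OF f] L2_spaceD(1)[OF g]
  have cnjm: "(\<lambda>t. cnj (g t)) \<in> borel_measurable M"
    by (intro borel_measurable_continuous_on[OF _ L2_spaceD(1)[OF g]]) (auto intro: continuous_intros)
  have "integrable M (\<lambda>t. (cmod (f t))\<^sup>2 + (cmod (g t))\<^sup>2)"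
    using f g by (intro Bochner_Integration.integrable_add L2_spaceD(2)) auto
  then show ?thesis
  proof (rule Bochner_Integration.integrable_bound)
    have "cmod z * cmod w \<le> (cmod z)\<^sup>2 + (cmod w)\<^sup>2" for z w
      using sum_squares_bound[of "cmod z" "cmod w"] mult_nonneg_nonneg[OF norm_ge_zero[of z] norm_ge_zero[of w]]
      by linarith
    then show "AE t in M. norm (f t * cnj (g t)) \<le> norm ((cmod (f t))\<^sup>2 + (cmod (g t))\<^sup>2)"
      by (simp add: norm_mult)
  qed (use cnjm in measurable)
qed

text \<open>This is Cauchy-Schwarz, taken from its version for nonnegative extended integrals;
  integrability of |f| |g| brings it back to real integrals.\<close>

lemma L2_inner_bound:
  assumes f: "f \<in> L2_space M" and g: "g \<in> L2_space M"
  shows "cmod (L2_inner M f g) \<le> L2_norm M f * L2_norm M g"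
proof -
  note [measurable] = L2_spaceD(1)[OF f] L2_spaceD(1)[OF g]
  have *: "(\<integral>\<^sup>+ t. (ennreal (cmod (h t)))\<^sup>2 \<partial>M) = ennreal ((L2_norm M h)\<^sup>2)" if "h \<in> L2_space M" for h
    unfolding L2_norm_power2 ennreal_power[OF norm_ge_zero]
    by (rule nn_integral_eq_integral) (use L2_spaceD[OF that] in auto)
  let ?I = "LINT t|M. cmod (f t) * cmod (g t)"
  have int: "integrable M (\<lambda>t. cmod (f t) * cmod (g t))"
    using integrable_norm[OF integrable_L2_mult[OF f g]] by (simp add: norm_mult)
  have "ennreal (?I\<^sup>2) = (\<integral>\<^sup>+ t. ennreal (cmod (f t)) * ennreal (cmod (g t)) \<partial>M)\<^sup>2"
    by (simp add: nn_integral_eq_integral[OF int] ennreal_power flip: ennreal_mult)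
  also have "\<dots> \<le> (\<integral>\<^sup>+ t. (ennreal (cmod (f t)))\<^sup>2 \<partial>M) * (\<integral>\<^sup>+ t. (ennreal (cmod (g t)))\<^sup>2 \<partial>M)"
    by (rule Cauchy_Schwarz_nn_integral) measurable
  also have "\<dots> = ennreal ((L2_norm M f * L2_norm M g)\<^sup>2)"
    unfolding *[OF f] *[OF g] by (simp add: ennreal_mult power_mult_distrib)
  finally have "?I\<^sup>2 \<le> (L2_norm M f * L2_norm M g)\<^sup>2"
    by simp
  then have "?I \<le> L2_norm M f * L2_norm M g"
    by (rule power2_le_imp_le) simp
  moreover have "cmod (L2_inner M f g) \<le> ?I"
    unfolding L2_inner_def using integral_norm_bound[of M "\<lambda>t. f t * cnj (g t)"]
    by (simp add: norm_mult)
  ultimately show ?thesis by linarith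
qed

lemma L2_inner_self: "L2_inner M f f = of_real ((L2_norm M f)\<^sup>2)"
  by (simp add: L2_inner_def L2_norm_power2 complex_norm_square[symmetric] flip: of_real_power)

lemma L2_inner_diff_left:
  assumes "f \<in> L2_space M" "g \<in> L2_space M" "h \<in> L2_space M"
  shows "L2_inner M (\<lambda>t. f t - g t) h = L2_inner M f h - L2_inner M g h"
  using assms by (simp add: L2_inner_def left_diff_distrib integrable_L2_mult)

lemma L2_inner_diff_right:
  assumes "f \<in> L2_space M" "g \<in> L2_space M" "h \<in> L2_space M"
  shows "L2_inner M h (\<lambda>t. f t - g t) = L2_inner M h f - L2_inner M h g"
  using assms by (simp add: L2_inner_def right_diff_distrib integrable_L2_mult)

lemma L2_inner_tendsto:
  assumes F: "\<And>k. F k \<in> L2_space M" and f: "f \<in> L2_space M"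
    and G: "\<And>k. G k \<in> L2_space M" and g: "g \<in> L2_space M"
    and Ff: "(\<lambda>k. L2_norm M (\<lambda>t. F k t - f t)) \<longlonglongrightarrow> 0"
    and Gg: "(\<lambda>k. L2_norm M (\<lambda>t. G k t - g t)) \<longlonglongrightarrow> 0"
  shows "(\<lambda>k. L2_inner M (F k) (G k)) \<longlonglongrightarrow> L2_inner M f g"
proof -
  let ?F = "\<lambda>k t. F k t - f t" and ?G = "\<lambda>k t. G k t - g t"
  note d = L2_space_diff[OF F f] L2_space_diff[OF G g]
  \<comment> \<open>Expansion around the limit: every term on the right contains a factor that tends
    to 0.\<close>
  have *: "L2_inner M (F k) (G k) - L2_inner M f g =
      L2_inner M (?F k) (?G k) + L2_inner M (?F k) g + L2_inner M f (?G k)" for k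
    using L2_inner_diff_left[OF F f d(2)] L2_inner_diff_left[OF F f g]
      L2_inner_diff_right[OF G g F] L2_inner_diff_right[OF G g f] by simp
  have "(\<lambda>k. L2_norm M (?F k) * L2_norm M (?G k) + L2_norm M (?F k) * L2_norm M g
      + L2_norm M f * L2_norm M (?G k)) \<longlonglongrightarrow> 0 * 0 + 0 * L2_norm M g + L2_norm M f * 0"
    by (intro tendsto_intros Ff Gg)
  then have "(\<lambda>k. L2_norm M (?F k) * L2_norm M (?G k) + L2_norm M (?F k) * L2_norm M g
      + L2_norm M f * L2_norm M (?G k)) \<longlonglongrightarrow> 0" by simp
  then have "(\<lambda>k. L2_inner M (F k) (G k) - L2_inner M f g) \<longlonglongrightarrow> 0"
  proof (rule Lim_null_comparison[rotated], intro always_eventually allI)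
    fix k
    show "norm (L2_inner M (F k) (G k) - L2_inner M f g) \<le> L2_norm M (?F k) * L2_norm M (?G k)
      + L2_norm M (?F k) * L2_norm M g + L2_norm M f * L2_norm M (?G k)"
      unfolding * using L2_inner_bound[OF d(1)[of k] d(2)[of k]] L2_inner_bound[OF d(1)[of k] g]
        L2_inner_bound[OF f d(2)[of k]]
      by (intro norm_triangle_le) (auto intro!: norm_triangle_le add_mono)
  qed
  then show ?thesis by (simp add: LIM_zero_iff)
qed

text \<open>Graph convergence makes both (T f, f) and the norm of f converge, and the reals are
  closed, so the bound and the reality clause survive with the same constant. This reduces both
  operators to their explicit cores.\<close>

lemma lower_semibounded_op_closure_iff:
  assumes T: "T \<subseteq> L2_space M \<times> L2_space M"
  shows "lower_semibounded M (op_closure M T) \<longleftrightarrow> lower_semibounded M T"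
proof
  have "T \<subseteq> op_closure M T"
  proof clarify
    fix f g assume fg: "(f, g) \<in> T"
    then show "(f, g) \<in> op_closure M T"
      using T unfolding op_closure_def mem_Collect_eq case_prod_conv
      by (intro conjI exI[where x="\<lambda>_. f"] exI[where x="\<lambda>_. g"]) (auto simp: L2_norm_def)
  qed
  then show "lower_semibounded M (op_closure M T) \<Longrightarrow> lower_semibounded M T"
    unfolding lower_semibounded_def by blast
next
  assume "lower_semibounded M T"
  then obtain c where c: "\<And>f g. (f, g) \<in> T \<Longrightarrow> L2_inner M g f \<in> \<real>"
    "\<And>f g. (f, g) \<in> T \<Longrightarrow> Re (L2_inner M g f) \<ge> c * (L2_norm M f)\<^sup>2"
    unfolding lower_semibounded_def by blast
  show "lower_semibounded M (op_closure M T)"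
    unfolding lower_semibounded_def
  proof (intro exI[of _ c] ballI, clarify)
    fix f g assume "(f, g) \<in> op_closure M T"
    then obtain F G where f: "f \<in> L2_space M" and g: "g \<in> L2_space M"
      and FG: "\<And>k::nat. (F k, G k) \<in> T"
      and Ff: "(\<lambda>k. L2_norm M (\<lambda>t. F k t - f t)) \<longlonglongrightarrow> 0"
      and Gg: "(\<lambda>k. L2_norm M (\<lambda>t. G k t - g t)) \<longlonglongrightarrow> 0"
      unfolding op_closure_def by blast
    have F: "F k \<in> L2_space M" and G: "G k \<in> L2_space M" for k
      using FG[of k] T by auto
    have lim: "(\<lambda>k. L2_inner M (G k) (F k)) \<longlonglongrightarrow> L2_inner M g f"
      by (rule L2_inner_tendsto[OF G g F f Gg Ff])
    \<comment> \<open>Convergence of the norms is the same continuity statement with equal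
      arguments.\<close>
    have "(\<lambda>k. Re (L2_inner M (F k) (F k))) \<longlonglongrightarrow> Re (L2_inner M f f)"
      by (intro tendsto_Re L2_inner_tendsto[OF F f F f Ff Ff])
    then have "(\<lambda>k. c * (L2_norm M (F k))\<^sup>2) \<longlonglongrightarrow> c * (L2_norm M f)\<^sup>2"
      unfolding L2_inner_self by (intro tendsto_mult_left) simp
    then have "Re (L2_inner M g f) \<ge> c * (L2_norm M f)\<^sup>2"
      by (rule LIMSEQ_le[OF _ tendsto_Re[OF lim]]) (use c(2)[OF FG] in auto)
    moreover have "L2_inner M g f \<in> \<real>"
      by (rule closed_sequentially[OF closed_complex_Reals _ lim]) (use c(1)[OF FG] in auto)
    ultimately show "L2_inner M g f \<in> \<real> \<and> Re (L2_inner M g f) \<ge> c * (L2_norm M f)\<^sup>2"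
      by simp
  qed
qed

section \<open>The form of the Jacobi operator\<close>

lemma integrable_count_space_finite_support:
  fixes f :: "'a \<Rightarrow> 'b::{banach, second_countable_topology}"
  assumes "finite S" "S \<subseteq> A" "\<And>x. x \<in> A - S \<Longrightarrow> f x = 0"
  shows "integrable (count_space A) f"
proof (rule integrableI_bounded)
  have "(\<integral>\<^sup>+ x. ennreal (norm (f x)) \<partial>count_space A) = (\<Sum>x\<in>S. ennreal (norm (f x)))"
    using assms by (intro nn_integral_count_space') auto
  also have "\<dots> < \<infinity>"
    by (simp add: sum_ennreal)
  finally show "(\<integral>\<^sup>+ x. ennreal (norm (f x)) \<partial>count_space A) < \<infinity>" .
qed simp

lemma L2_space_count_space_finite_support:
  assumes "finite S" "S \<subseteq> A" "\<And>x. x \<in> A - S \<Longrightarrow> f x = 0"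
  shows "f \<in> L2_space (count_space A)"
  using assms by (auto simp: L2_space_def intro!: integrable_count_space_finite_support[of S])

lemma integral_count_space_nat_support:
  fixes h :: "nat \<Rightarrow> 'b::{banach, second_countable_topology}"
  assumes "\<And>n. n \<ge> N \<Longrightarrow> h n = 0"
  shows "(LINT t|count_space {1..}. h t) = (\<Sum>n=1..<N. h n)"
proof -
  have fin: "finite {n \<in> {1..}. h n \<noteq> 0}"
    by (rule finite_subset[of _ "{..<N}"]) (use assms not_less in auto)
  show ?thesis
    unfolding lebesgue_integral_count_space_finite_support[OF fin]
    by (rule sum.mono_neutral_left) (use assms in \<open>auto simp: Suc_le_eq, meson linorder_not_less\<close>)
qed

text \<open>The Dirichlet form of a path graph whose edge from n to n + 1 has resistance
  \<open>d (n + 1)\<close>, plus a potential on the vertices from 1 on. The last edge ends at N,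
  where \<open>y\<close> vanishes in all uses.\<close>

definition graph_form :: "(nat \<Rightarrow> real) \<Rightarrow> (nat \<Rightarrow> real) \<Rightarrow> nat \<Rightarrow> (nat \<Rightarrow> complex) \<Rightarrow> real" where
  "graph_form d \<alpha> N y =
     (\<Sum>n<N. (cmod (y (n + 1) - y n))\<^sup>2 / d (n + 1)) + (\<Sum>n=1..<N. \<alpha> n * (cmod (y n))\<^sup>2)"

text \<open>Twice the trapezoidal rule for the integral of |f|^2. Grouped by vertices instead of
  edges, vertex n \<ge> 1 carries the weight d_n + d_(n+1), the square of
  \<open>r n\<close>.\<close>

definition graph_mass :: "(nat \<Rightarrow> real) \<Rightarrow> nat \<Rightarrow> (nat \<Rightarrow> complex) \<Rightarrow> real" where
  "graph_mass d N y = (\<Sum>n<N. d (n + 1) * ((cmod (y n))\<^sup>2 + (cmod (y (n + 1)))\<^sup>2))"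

definition graph_form_bounded :: "(nat \<Rightarrow> real) \<Rightarrow> (nat \<Rightarrow> real) \<Rightarrow> bool" where
  "graph_form_bounded d \<alpha> \<longleftrightarrow> (\<exists>c. \<forall>y N. y 0 = 0 \<longrightarrow> (\<forall>n\<ge>N. y n = 0) \<longrightarrow>
     c * graph_mass d N y \<le> graph_form d \<alpha> N y)"

lemma jacobi_matrix_row:
  assumes "finite {j. u j \<noteq> 0}" and "u 0 = 0" and i: "i \<ge> 1"
  shows "(\<Sum>j | u j \<noteq> 0. complex_of_real (jacobi_matrix a c i j) * u j) =
    of_real (c (i - 1)) * u (i - 1) + of_real (a i) * u i + of_real (c i) * u (i + 1)"
proof -
  have "(\<Sum>j | u j \<noteq> 0. complex_of_real (jacobi_matrix a c i j) * u j) =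
    (\<Sum>j\<in>{i - 1, i, i + 1}. complex_of_real (jacobi_matrix a c i j) * u j)"
    using assms by (intro sum.mono_neutral_cong) (auto simp: jacobi_matrix_def)
  also have "\<dots> = of_real (c (i - 1)) * u (i - 1) + of_real (a i) * u i + of_real (c i) * u (i + 1)"
    using i by (cases i) (auto simp: jacobi_matrix_def)
  finally show ?thesis .
qed

text \<open>Summation by parts. The boundary term is kept so that the induction closes; in the
  application it vanishes because \<open>y\<close> is 0 at the upper end.\<close>

lemma sum_second_difference:
  fixes y :: "nat \<Rightarrow> complex" and w :: "nat \<Rightarrow> complex"
  assumes "y 0 = 0"
  shows "(\<Sum>n=1..<Suc N. (w n + w (n + 1)) * (y n * cnj (y n)) - w (n + 1) * (y (n + 1) * cnj (y n))
        - w n * (y (n - 1) * cnj (y n)))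
      + w (N + 1) * ((y (N + 1) - y N) * cnj (y (N + 1)))
    = (\<Sum>n<Suc N. w (n + 1) * ((y (n + 1) - y n) * cnj (y (n + 1) - y n)))"
proof (induction N)
  case 0
  then show ?case using assms by simp
next
  case (Suc N)
  have "(\<Sum>n=1..<Suc (Suc N). (w n + w (n + 1)) * (y n * cnj (y n)) - w (n + 1) * (y (n + 1) * cnj (y n))
        - w n * (y (n - 1) * cnj (y n)))
    = (\<Sum>n=1..<Suc N. (w n + w (n + 1)) * (y n * cnj (y n)) - w (n + 1) * (y (n + 1) * cnj (y n))
        - w n * (y (n - 1) * cnj (y n))) + ((w (N + 1) + w (N + 2)) * (y (N + 1) * cnj (y (N + 1)))
        - w (N + 2) * (y (N + 2) * cnj (y (N + 1))) - w (N + 1) * (y N * cnj (y (N + 1))))"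
    by (subst sum.atLeastLessThan_Suc) auto
  moreover have "(\<Sum>n<Suc (Suc N). w (n + 1) * ((y (n + 1) - y n) * cnj (y (n + 1) - y n))) =
     (\<Sum>n<Suc N. w (n + 1) * ((y (n + 1) - y n) * cnj (y (n + 1) - y n)))
     + w (N + 2) * ((y (N + 2) - y (N + 1)) * cnj (y (N + 2) - y (N + 1)))"
    by (subst sum.lessThan_Suc) auto
  ultimately show ?case
    using Suc by (simp add: algebra_simps)
qed

text \<open>Since r_n > 0, the substitution u_n = r_n y_n is invertible. It cancels every
  \<open>r\<close> in the form and leaves a weighted second difference of \<open>y\<close> plus the
  potential \<alpha>.\<close>

lemma min_jacobi_op_semibounded_iff:
  assumes d: "\<And>n. n \<ge> 1 \<Longrightarrow> d n > 0"
    and r: "\<And>n. n \<ge> 1 \<Longrightarrow> r n = sqrt (d n + d (n + 1))"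
  shows "lower_semibounded (count_space {1..})
      (min_jacobi_op
        (\<lambda>n. 1 / (r n)\<^sup>2 * (\<alpha> n + 1 / d n + 1 / d (n + 1)))
        (\<lambda>n. - (1 / (r n * r (n + 1) * d (n + 1))))) \<longleftrightarrow> graph_form_bounded d \<alpha>"
    (is "lower_semibounded ?M (min_jacobi_op ?a ?c) \<longleftrightarrow> _")
proof -
  define A where "A u i = (\<Sum>j | u j \<noteq> 0. complex_of_real (jacobi_matrix ?a ?c i j) * u j)" for u i
  define T where "T = {(u, A u) | u. finite {j. u j \<noteq> 0} \<and> {j. u j \<noteq> 0} \<subseteq> {1..}}"
  have rpos: "r n > 0" "(r n)\<^sup>2 = d n + d (n + 1)" if "n \<ge> 1" for n
    using d[of n] d[of "n + 1"] r[of n] that by auto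
  have row: "A u i = of_real (?c (i - 1)) * u (i - 1) + of_real (?a i) * u i + of_real (?c i) * u (i + 1)"
    if "u 0 = 0" "\<forall>n\<ge>N. u n = 0" "i \<ge> 1" for u N i
  proof -
    have "finite {j. u j \<noteq> 0}"
      by (rule finite_subset[of _ "{..<N}"]) (use that not_less in auto)
    then show ?thesis
      unfolding A_def by (rule jacobi_matrix_row) (use that in auto)
  qed
  have A0: "A u i = 0" if "u 0 = 0" "\<forall>n\<ge>N. u n = 0" "i \<ge> N + 1" for u N i
    using row[OF that(1,2), of i] that by simp
  have T_eq: "T = {(u, A u) | u. u 0 = 0 \<and> (\<exists>N. \<forall>n\<ge>N. u n = 0)}"
  proof -
    have "finite {j. u j \<noteq> 0} \<and> {j. u j \<noteq> 0} \<subseteq> {1..} \<longleftrightarrow> u 0 = 0 \<and> (\<exists>N. \<forall>n\<ge>N. u n = 0)"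
      for u :: "nat \<Rightarrow> complex"
    proof -
      have "finite {j. u j \<noteq> 0} \<longleftrightarrow> (\<exists>N. \<forall>n\<ge>N. u n = 0)"
        unfolding finite_nat_set_iff_bounded by (metis (mono_tags) mem_Collect_eq not_less)
      moreover have "{j. u j \<noteq> 0} \<subseteq> {1..} \<longleftrightarrow> u 0 = 0"
        by (auto simp: Suc_le_eq) (metis not_gr_zero)
      ultimately show ?thesis by blast
    qed
    then show ?thesis unfolding T_def by auto
  qed
  have T_L2: "T \<subseteq> L2_space ?M \<times> L2_space ?M"
  proof -
    have "u \<in> L2_space ?M \<and> A u \<in> L2_space ?M" if "u 0 = 0" "\<forall>n\<ge>N. u n = 0" for u N
      using that A0[OF that]
      by (intro conjI L2_space_count_space_finite_support[of "{1..N}"]) auto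
    then show ?thesis unfolding T_eq by blast
  qed
  have form: "L2_inner ?M (A u) u = of_real (graph_form d \<alpha> N y)"
      and mass: "(L2_norm ?M u)\<^sup>2 = graph_mass d N y"
    if u0: "u 0 = 0" and uN: "\<forall>n\<ge>N. u n = 0" and y0: "y 0 = 0" and uy: "\<And>n. n \<ge> 1 \<Longrightarrow> u n = of_real (r n) * y n"
    for u y N
  proof -
    have yN: "y n = 0" if "n \<ge> N" for n
      using uy[of n] uN rpos(1)[of n] y0 that by (cases "n = 0") auto
    define w where "w n = complex_of_real (1 / d n)" for n
    have trm: "A u n * cnj (u n) = of_real (\<alpha> n * (cmod (y n))\<^sup>2) +
       ((w n + w (n + 1)) * (y n * cnj (y n)) - w (n + 1) * (y (n + 1) * cnj (y n))
        - w n * (y (n - 1) * cnj (y n)))" if n: "n \<ge> 1" for n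
    proof -
      have r1: "r n \<noteq> 0" "r (n + 1) \<noteq> 0" "d n \<noteq> 0" "d (n + 1) \<noteq> 0"
        using rpos(1)[of n] rpos(1)[of "n + 1"] d[of n] d[of "n + 1"] n by auto
      have "of_real (?c (n - 1)) * u (n - 1) * cnj (u n) = - w n * (y (n - 1) * cnj (y n))"
      \<comment> \<open>For n = 1 the coefficient \<open>?c 0\<close> contains \<open>r 0\<close>,
        about which nothing is assumed, but it multiplies \<open>u 0 = 0\<close>.\<close>
      proof (cases "n = 1")
        case True then show ?thesis using u0 y0 by simp
      next
        case False
        then have "n - 1 \<ge> 1" using n by simp
        then have "r (n - 1) \<noteq> 0" using rpos(1)[of "n - 1"] by simp
        then show ?thesis
          using False n r1 uy[of n] uy[of "n - 1"] by (simp add: w_def field_simps)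
      qed
      moreover have "of_real (?c n) * u (n + 1) * cnj (u n) = - w (n + 1) * (y (n + 1) * cnj (y n))"
        using n r1 uy[of n] uy[of "n + 1"] by (simp add: w_def field_simps)
      moreover have "of_real (?a n) * u n * cnj (u n) = (of_real (\<alpha> n) + w n + w (n + 1)) * (y n * cnj (y n))"
        using n r1 uy[of n] by (simp add: w_def power2_eq_square)
      ultimately show ?thesis
        unfolding row[OF u0 uN n] complex_norm_square of_real_mult distrib_right by (simp add: algebra_simps)
    qed
    show "L2_inner ?M (A u) u = of_real (graph_form d \<alpha> N y)"
    proof (cases N)
      case 0
      have "u = (\<lambda>_. 0)" using uN 0 by auto
      then show ?thesis by (simp add: 0 L2_inner_def graph_form_def)
    next
      case (Suc N')
      have "L2_inner ?M (A u) u = (\<Sum>n=1..<N. A u n * cnj (u n))"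
        unfolding L2_inner_def by (rule integral_count_space_nat_support) (use uN in auto)
      also have "\<dots> = (\<Sum>n=1..<N. of_real (\<alpha> n * (cmod (y n))\<^sup>2)) +
         (\<Sum>n=1..<N. (w n + w (n + 1)) * (y n * cnj (y n)) - w (n + 1) * (y (n + 1) * cnj (y n))
        - w n * (y (n - 1) * cnj (y n)))"
        by (simp add: trm sum.distrib)
      \<comment> \<open>The boundary term of the summation by parts contains
        \<open>y N = 0\<close>.\<close>
      also have "(\<Sum>n=1..<N. (w n + w (n + 1)) * (y n * cnj (y n)) - w (n + 1) * (y (n + 1) * cnj (y n))
        - w n * (y (n - 1) * cnj (y n))) = (\<Sum>n<N. w (n + 1) * ((y (n + 1) - y n) * cnj (y (n + 1) - y n)))"
        using sum_second_difference[of y w N', OF y0] yN[of N] unfolding Suc by simp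
      also have "\<dots> = of_real (\<Sum>n<N. (cmod (y (n + 1) - y n))\<^sup>2 / d (n + 1))"
        unfolding of_real_sum complex_norm_square of_real_divide by (simp add: w_def)
      finally show ?thesis unfolding graph_form_def by simp
    qed
    show "(L2_norm ?M u)\<^sup>2 = graph_mass d N y"
    proof (cases N)
      case 0
      have "u = (\<lambda>_. 0)" using uN 0 by auto
      then show ?thesis by (simp add: 0 L2_norm_def graph_mass_def)
    next
      case (Suc N')
      have "(L2_norm ?M u)\<^sup>2 = (\<Sum>n=1..<N. (cmod (u n))\<^sup>2)"
        unfolding L2_norm_power2 by (rule integral_count_space_nat_support) (use uN in auto)
      also have "\<dots> = (\<Sum>n=1..<N. (d n + d (n + 1)) * (cmod (y n))\<^sup>2)"
        by (intro sum.cong refl) (use rpos(2) in \<open>simp add: uy norm_mult power_mult_distrib\<close>)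
      also have "\<dots> = (\<Sum>n=1..<N. d n * (cmod (y n))\<^sup>2) + (\<Sum>n=1..<N. d (n + 1) * (cmod (y n))\<^sup>2)"
        by (simp add: distrib_right sum.distrib)
      \<comment> \<open>The mass of each vertex is shared between its two edges: the part with d_n
        is shifted to the edge on the left, gaining a term with \<open>y N = 0\<close>, and the
        other part gains a term with \<open>y 0 = 0\<close>.\<close>
      also have "(\<Sum>n=1..<N. d n * (cmod (y n))\<^sup>2) = (\<Sum>n<N. d (n + 1) * (cmod (y (n + 1)))\<^sup>2)"
        using sum.shift_bounds_Suc_ivl[of "\<lambda>n. d n * (cmod (y n))\<^sup>2" 0 N'] yN[of N]
        unfolding Suc by (simp add: atLeast0LessThan)
      also have "(\<Sum>n=1..<N. d (n + 1) * (cmod (y n))\<^sup>2) = (\<Sum>n<N. d (n + 1) * (cmod (y n))\<^sup>2)"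
        by (rule sum.mono_neutral_left) (use y0 in \<open>auto simp: Suc_le_eq\<close>)
      finally show ?thesis
        unfolding graph_mass_def by (simp add: sum.distrib distrib_left)
    qed
  qed
  have "lower_semibounded ?M (min_jacobi_op ?a ?c) \<longleftrightarrow> lower_semibounded ?M T"
    unfolding min_jacobi_op_def A_def[symmetric] T_def[symmetric]
    by (rule lower_semibounded_op_closure_iff[OF T_L2])
  also have "\<dots> \<longleftrightarrow> graph_form_bounded d \<alpha>"
  proof
    assume "lower_semibounded ?M T"
    then obtain c where c: "\<And>u v. (u, v) \<in> T \<Longrightarrow> Re (L2_inner ?M v u) \<ge> c * (L2_norm ?M u)\<^sup>2"
      unfolding lower_semibounded_def by blast
    show "graph_form_bounded d \<alpha>"
      unfolding graph_form_bounded_def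
    proof (intro exI[of _ c] allI impI)
      fix y :: "nat \<Rightarrow> complex" and N assume y: "y 0 = 0" "\<forall>n\<ge>N. y n = 0"
      define u where "u n = of_real (r n) * y n" for n
      have u: "u 0 = 0" "\<forall>n\<ge>N. u n = 0" using y by (auto simp: u_def)
      have "(u, A u) \<in> T" using u unfolding T_eq by blast
      from c[OF this] show "c * graph_mass d N y \<le> graph_form d \<alpha> N y"
        using form[OF u y(1) u_def] mass[OF u y(1) u_def] by simp
    qed
  next
    assume "graph_form_bounded d \<alpha>"
    then obtain c where c: "\<And>y N. y 0 = 0 \<Longrightarrow> (\<forall>n\<ge>N. y n = 0) \<Longrightarrow> c * graph_mass d N y \<le> graph_form d \<alpha> N y"
      unfolding graph_form_bounded_def by blast
    show "lower_semibounded ?M T"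
      unfolding lower_semibounded_def
    proof (intro exI[of _ c] ballI, clarify)
      fix u v assume "(u, v) \<in> T"
      then obtain N where v: "v = A u" and u: "u 0 = 0" "\<forall>n\<ge>N. u n = 0"
        unfolding T_eq by auto
      define y where "y n = (if n = 0 then 0 else u n / of_real (r n))" for n
      have y: "y 0 = 0" "\<forall>n\<ge>N. y n = 0" using u by (auto simp: y_def)
      have uy: "u n = of_real (r n) * y n" if "n \<ge> 1" for n
        using that rpos(1)[of n] by (auto simp: y_def)
      show "L2_inner ?M v u \<in> \<real> \<and> Re (L2_inner ?M v u) \<ge> c * (L2_norm ?M u)\<^sup>2"
        using c[OF y] form[OF u y(1) uy] mass[OF u y(1) uy] by (simp add: v)
    qed
  qed
  finally show ?thesis .
qed

section \<open>Absolutely continuous functions\<close>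

definition interval_family :: "real \<Rightarrow> real \<Rightarrow> (real \<times> real) set \<Rightarrow> bool" where
  "interval_family a c P \<longleftrightarrow> finite P \<and> (\<forall>(u, v) \<in> P. a \<le> u \<and> u \<le> v \<and> v \<le> c) \<and>
     disjoint_family_on (\<lambda>(u, v). {u<..<v}) P"

lemma AC_on_iff:
  "AC_on a c f \<longleftrightarrow> (\<forall>\<epsilon>>0. \<exists>\<delta>>0. \<forall>P. interval_family a c P \<longrightarrow>
     (\<Sum>(u, v)\<in>P. v - u) < \<delta> \<longrightarrow> (\<Sum>(u, v)\<in>P. cmod (f v - f u)) < \<epsilon>)"
  unfolding AC_on_def interval_family_def by (simp only: imp_conjL)

lemma AC_on_imp_continuous_on:
  assumes "AC_on a c f"
  shows "continuous_on {a..c} f"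
  unfolding continuous_on_iff
proof (intro ballI allI impI)
  fix t e :: real assume t: "t \<in> {a..c}" and "0 < e"
  with assms obtain \<delta> where "\<delta> > 0" and \<delta>: "\<And>P. interval_family a c P \<Longrightarrow>
     (\<Sum>(u, v)\<in>P. v - u) < \<delta> \<Longrightarrow> (\<Sum>(u, v)\<in>P. cmod (f v - f u)) < e"
    unfolding AC_on_iff by blast
  have "dist (f s) (f t) < e" if "s \<in> {a..c}" "dist s t < \<delta>" for s
    using \<delta>[of "{(min s t, max s t)}"] that t
    by (cases "s \<le> t") (auto simp: interval_family_def disjoint_family_on_def dist_norm norm_minus_commute)
  with \<open>\<delta> > 0\<close> show "\<exists>d>0. \<forall>s\<in>{a..c}. dist s t < d \<longrightarrow> dist (f s) (f t) < e"
    by blast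
qed

lemma AC_on_cnj: "AC_on a c f \<Longrightarrow> AC_on a c (\<lambda>t. cnj (f t))"
  unfolding AC_on_def by (simp flip: complex_cnj_diff)

text \<open>Both factors are continuous, hence bounded on the compact interval, and an increment of
  the product is split into increments of the factors.\<close>

lemma AC_on_mult:
  assumes f: "AC_on a c f" and g: "AC_on a c g"
  shows "AC_on a c (\<lambda>t. f t * g t)"
  unfolding AC_on_iff
proof (intro allI impI)
  fix e :: real assume "e > 0"
  have "bounded (f ` {a..c} \<union> g ` {a..c})"
    using f g by (intro bounded_Un[THEN iffD2] conjI compact_imp_bounded compact_continuous_image AC_on_imp_continuous_on) auto
  then obtain K where K: "K > 0" "\<And>t. t \<in> {a..c} \<Longrightarrow> cmod (f t) \<le> K" "\<And>t. t \<in> {a..c} \<Longrightarrow> cmod (g t) \<le> K"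
    unfolding bounded_pos by (metis UnCI image_eqI)
  have e: "e / (2 * K) > 0" using \<open>e > 0\<close> K by simp
  from f e obtain \<delta>1 where "\<delta>1 > 0" and \<delta>1: "\<And>P. interval_family a c P \<Longrightarrow>
     (\<Sum>(u, v)\<in>P. v - u) < \<delta>1 \<Longrightarrow> (\<Sum>(u, v)\<in>P. cmod (f v - f u)) < e / (2 * K)"
    unfolding AC_on_iff by blast
  from g e obtain \<delta>2 where "\<delta>2 > 0" and \<delta>2: "\<And>P. interval_family a c P \<Longrightarrow>
     (\<Sum>(u, v)\<in>P. v - u) < \<delta>2 \<Longrightarrow> (\<Sum>(u, v)\<in>P. cmod (g v - g u)) < e / (2 * K)"
    unfolding AC_on_iff by blast
  show "\<exists>\<delta>>0. \<forall>P. interval_family a c P \<longrightarrow>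
     (\<Sum>(u, v)\<in>P. v - u) < \<delta> \<longrightarrow> (\<Sum>(u, v)\<in>P. cmod (f v * g v - f u * g u)) < e"
  proof (intro exI[of _ "min \<delta>1 \<delta>2"] conjI allI impI)
    fix P :: "(real \<times> real) set"
    assume P: "interval_family a c P" "(\<Sum>(u, v)\<in>P. v - u) < min \<delta>1 \<delta>2"
    have "(\<Sum>(u, v)\<in>P. cmod (f v * g v - f u * g u))
        \<le> (\<Sum>(u, v)\<in>P. K * cmod (f v - f u) + K * cmod (g v - g u))"
    proof (rule sum_mono, clarify)
      fix u v assume "(u, v) \<in> P"
      then have uv: "u \<in> {a..c}" "v \<in> {a..c}" using P(1) by (auto simp: interval_family_def)
      have "f v * g v - f u * g u = (f v - f u) * g v + f u * (g v - g u)"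
        by (simp add: algebra_simps)
      also have "cmod \<dots> \<le> cmod (f v - f u) * cmod (g v) + cmod (f u) * cmod (g v - g u)"
        by (metis norm_mult norm_triangle_ineq)
      also have "\<dots> \<le> cmod (f v - f u) * K + K * cmod (g v - g u)"
        using K uv by (intro add_mono mult_mono) auto
      finally show "cmod (f v * g v - f u * g u) \<le> K * cmod (f v - f u) + K * cmod (g v - g u)"
        by (simp add: mult.commute)
    qed
    also have "\<dots> = K * (\<Sum>(u, v)\<in>P. cmod (f v - f u)) + K * (\<Sum>(u, v)\<in>P. cmod (g v - g u))"
      by (simp add: sum.distrib sum_distrib_left case_prod_unfold)
    also have "\<dots> < K * (e / (2 * K)) + K * (e / (2 * K))"
      using P by (intro add_strict_mono mult_strict_left_mono \<delta>1 \<delta>2 K(1)) auto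
    also have "\<dots> = e" using K(1) by simp
    finally show "(\<Sum>(u, v)\<in>P. cmod (f v * g v - f u * g u)) < e" .
  qed (use \<open>\<delta>1 > 0\<close> \<open>\<delta>2 > 0\<close> in auto)
qed

lemma negligible_subset_open_small:
  assumes "negligible N" "\<delta> > 0"
  obtains T where "open T" "N \<subseteq> T" "T \<in> lmeasurable" "measure lebesgue T < \<delta>"
proof -
  have N: "N \<in> lmeasurable" "measure lebesgue N = 0"
    using assms negligible_iff_measure by blast+
  obtain T where T: "open T" "N \<subseteq> T" "T - N \<in> lmeasurable" "emeasure lebesgue (T - N) < ennreal \<delta>"
    using sets_lebesgue_outer_open[OF fmeasurableD[OF N(1)] assms(2)] by blast
  have "measure lebesgue (T - N) < \<delta>"
    using T(4) emeasure_eq_measure2[OF T(3)] assms(2) by (simp add: ennreal_less_iff)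
  have "T = (T - N) \<union> N" using T(2) by blast
  then have "T \<in> lmeasurable" "measure lebesgue T \<le> measure lebesgue (T - N) + measure lebesgue N"
    using fmeasurable.Un[OF T(3) N(1)] measure_Un_le[of "T - N" lebesgue N] N(1) T(3) by (metis fmeasurableD)+
  then show ?thesis using that[of T] T N \<open>measure lebesgue (T - N) < \<delta>\<close> by simp
qed

text \<open>Fundamental theorem of calculus for absolutely continuous functions, with integrability
  of \<open>h\<close> as part of the conclusion. The gauge treats tags in two ways: off N the
  derivative estimate bounds the error by a multiple of the cell length; on N the cells are forced
  into an open set T of measure below \<delta>, so absolute continuity makes their increments of
  \<open>g\<close> small in total.\<close>

theorem AC_on_has_integral:
  fixes g h :: "real \<Rightarrow> complex"
  assumes ac: "AC_on a c g" and "a \<le> c" and N: "negligible N"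
    and der: "\<And>t. t \<in> {a..c} - N \<Longrightarrow> (g has_vector_derivative h t) (at t within {a..c})"
  shows "(h has_integral (g c - g a)) {a..c}"
proof -
  \<comment> \<open>With value 0 on N, the cells tagged in N contribute nothing to the Riemann sum,
    only the increment of \<open>g\<close>.\<close>
  define h' where "h' t = (if t \<in> N then 0 else h t)" for t
  have "(h' has_integral (g c - g a)) {a..c}"
    unfolding has_integral_real
  proof (intro allI impI)
    fix e :: real assume "e > 0"
    then obtain \<delta> where "\<delta> > 0" and \<delta>: "\<And>P. interval_family a c P \<Longrightarrow>
       (\<Sum>(u, v)\<in>P. v - u) < \<delta> \<Longrightarrow> (\<Sum>(u, v)\<in>P. cmod (g v - g u)) < e / 2"
      using ac unfolding AC_on_iff by (meson half_gt_zero)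
    obtain T where T: "open T" "N \<subseteq> T" "T \<in> lmeasurable" "measure lebesgue T < \<delta>"
      using negligible_subset_open_small[OF N \<open>\<delta> > 0\<close>] .
    \<comment> \<open>The summand 1 keeps the denominator positive when a = c.\<close>
    define e' where "e' = e / (2 * (c - a + 1))"
    have e': "e' > 0" "e' * (c - a) < e / 2" using \<open>e > 0\<close> \<open>a \<le> c\<close> by (auto simp: e'_def field_simps)
    have "\<exists>\<rho>>0. (x \<in> N \<longrightarrow> ball x \<rho> \<subseteq> T) \<and> (x \<in> {a..c} - N \<longrightarrow>
       (\<forall>y\<in>{a..c}. \<bar>y - x\<bar> < \<rho> \<longrightarrow> cmod (g y - g x - (y - x) *\<^sub>R h x) \<le> e' * \<bar>y - x\<bar>))" for x
    proof (cases "x \<in> N")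
      case True
      then show ?thesis using T(1,2) open_contains_ball by auto
    next
      case False
      show ?thesis
      proof (cases "x \<in> {a..c}")
        case True
        with False der[of x] have "\<exists>\<rho>>0. \<forall>y\<in>{a..c}. \<bar>y - x\<bar> < \<rho> \<longrightarrow> cmod (g y - g x - (y - x) *\<^sub>R h x) \<le> e' * \<bar>y - x\<bar>"
          unfolding has_vector_derivative_def has_derivative_within_alt using e'(1) by auto
        with False show ?thesis by auto
      next
        case F2: False
        with False show ?thesis by (intro exI[of _ 1]) auto
      qed
    qed
    then obtain \<rho> where \<rho>: "\<And>x. \<rho> x > 0" "\<And>x. x \<in> N \<Longrightarrow> ball x (\<rho> x) \<subseteq> T"
      "\<And>x y. x \<in> {a..c} - N \<Longrightarrow> y \<in> {a..c} \<Longrightarrow> \<bar>y - x\<bar> < \<rho> x \<Longrightarrow> cmod (g y - g x - (y - x) *\<^sub>R h x) \<le> e' * \<bar>y - x\<bar>"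
      by metis
    show "\<exists>\<gamma>. gauge \<gamma> \<and> (\<forall>\<D>. \<D> tagged_division_of {a..c} \<and> \<gamma> fine \<D> \<longrightarrow>
        norm ((\<Sum>(x, k)\<in>\<D>. measure lborel k *\<^sub>R h' x) - (g c - g a)) < e)"
    proof (intro exI[of _ "\<lambda>x. ball x (\<rho> x)"] conjI allI impI)
      show "gauge (\<lambda>x. ball x (\<rho> x))" using \<rho>(1) by (auto simp: gauge_def)
      fix D assume "D tagged_division_of {a..c} \<and> (\<lambda>x. ball x (\<rho> x)) fine D"
      then have D: "D tagged_division_of {a..c}" and fine: "\<And>x k. (x, k) \<in> D \<Longrightarrow> k \<subseteq> ball x (\<rho> x)"
        by (auto simp: fine_def)
      note Dd = tagged_division_ofD[OF D]
      define G where "G k = g (Sup k) - g (Inf k)" for k :: "real set"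
      have kform: "\<exists>u v. k = {u..v} \<and> u \<le> x \<and> x \<le> v \<and> a \<le> u \<and> v \<le> c" if "(x, k) \<in> D" for x k
        using Dd(2,3)[OF that] Dd(4)[OF that] by (auto simp: box_real)
      define B where "B = {(x, k) \<in> D. x \<in> N}"
      define B' where "B' = {(x, k) \<in> B. interior k \<noteq> {}}"
      have BD: "B \<subseteq> D" "B' \<subseteq> B" "finite B" by (auto simp: B_def B'_def intro: finite_subset[OF _ Dd(1)])
      define p where "p = (\<lambda>(x :: real, k). (Inf k, Sup k) :: real \<times> real)"
      have pk: "{fst (p (x, k))<..<snd (p (x, k))} = interior k" "k = {fst (p (x, k))..snd (p (x, k))}" if "(x, k) \<in> D" for x k
        using kform[OF that] by (auto simp: p_def)
      have inj: "inj_on p B'"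
      proof (rule inj_onI, clarify)
        fix x k y l assume *: "(x, k) \<in> B'" "(y, l) \<in> B'" "p (x, k) = p (y, l)"
        then have "(x, k) \<in> D" "(y, l) \<in> D" using BD by auto
        then have "k = l" using pk(2) * by metis
        moreover have "interior k \<noteq> {}" using * by (simp add: B'_def)
        ultimately show "x = y \<and> k = l"
          using Dd(5)[OF \<open>(x, k) \<in> D\<close> \<open>(y, l) \<in> D\<close>] by auto
      qed
      have disj: "disjoint_family_on (\<lambda>(u, v). {u<..<v}) (p ` B')"
        unfolding disjoint_family_on_def
      proof (intro ballI impI)
        fix q q' assume "q \<in> p ` B'" "q' \<in> p ` B'" "q \<noteq> q'"
        then obtain x k y l where *: "(x, k) \<in> B'" "q = p (x, k)" "(y, l) \<in> B'" "q' = p (y, l)"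
          by auto
        with \<open>q \<noteq> q'\<close> have "(x, k) \<in> D" "(y, l) \<in> D" "(x, k) \<noteq> (y, l)" using BD by auto
        from Dd(5)[OF this] show "(\<lambda>(u, v). {u<..<v}) q \<inter> (\<lambda>(u, v). {u<..<v}) q' = {}"
          using pk(1)[OF \<open>(x, k) \<in> D\<close>] pk(1)[OF \<open>(y, l) \<in> D\<close>] *(2,4) by (simp add: case_prod_unfold)
      qed
      have finB': "finite (p ` B')" using BD finite_subset by blast
      have pB': "a \<le> u \<and> u \<le> v \<and> v \<le> c \<and> {u<..<v} \<subseteq> T" if "(u, v) \<in> p ` B'" for u v
      proof -
        from that obtain x k where xk: "(x, k) \<in> B'" "(u, v) = p (x, k)" by auto
        then have "(x, k) \<in> D" "x \<in> N" using BD by (auto simp: B'_def B_def)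
        then show ?thesis
          using kform[of x k] xk fine[of x k] \<rho>(2)[of x] pk[of x k] interior_subset[of k]
          by (auto simp: p_def)
      qed
      have len: "(\<Sum>(u, v)\<in>p ` B'. v - u) < \<delta>"
      proof -
        have "(\<Sum>(u, v)\<in>p ` B'. v - u) = (\<Sum>q\<in>p ` B'. measure lebesgue ((\<lambda>(u, v). {u<..<v}) q))"
          using pB' by (intro sum.cong) auto
        also have "\<dots> = measure lebesgue (\<Union>q\<in>p ` B'. (\<lambda>(u, v). {u<..<v}) q)"
          by (rule measure_finite_Union[symmetric]) (use finB' disj pB' in \<open>auto simp: emeasure_lborel_Ioo\<close>)
        also have "\<dots> \<le> measure lebesgue T"
        proof (rule measure_mono_fmeasurable[OF _ _ T(3)])
          show "(\<Union>q\<in>p ` B'. (\<lambda>(u, v). {u<..<v}) q) \<subseteq> T"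
          proof (rule UN_least)
            fix q assume "q \<in> p ` B'"
            then show "(\<lambda>(u, v). {u<..<v}) q \<subseteq> T" using pB'[of "fst q" "snd q"] by (simp add: case_prod_unfold)
          qed
          show "(\<Union>q\<in>p ` B'. (\<lambda>(u, v). {u<..<v}) q) \<in> sets lebesgue"
            by (rule sets.finite_UN[OF finB']) (simp add: case_prod_unfold)
        qed
        finally show ?thesis using T(4) by simp
      qed
      have bad: "(\<Sum>(x, k)\<in>B. cmod (G k)) < e / 2"
      proof -
        have "(\<Sum>(x, k)\<in>B. cmod (G k)) = (\<Sum>(x, k)\<in>B'. cmod (G k))"
        proof (rule sum.mono_neutral_right)
          show "\<forall>q\<in>B - B'. (case q of (x, k) \<Rightarrow> cmod (G k)) = 0"
          proof clarify
            fix x k assume *: "(x, k) \<in> B" "(x, k) \<notin> B'"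
            then have "(x, k) \<in> D" "interior k = {}" using BD by (auto simp: B'_def)
            then obtain u v where "k = {u..v}" "u \<le> v" "{u<..<v} = {}" using kform[of x k] by fastforce
            then show "cmod (G k) = 0" by (simp add: G_def)
          qed
        qed (use BD in auto)
        also have "\<dots> = (\<Sum>(u, v)\<in>p ` B'. cmod (g v - g u))"
          by (subst sum.reindex[OF inj]) (auto simp: G_def p_def intro!: sum.cong)
        also have "\<dots> < e / 2"
          by (rule \<delta>[OF _ len]) (unfold interval_family_def, use pB' finB' disj in blast)
        finally show ?thesis .
      qed
      \<comment> \<open>Straddle estimate: the tag lies between the end points, so the two distances
        to it add up to the length of the cell.\<close>
      have good: "(\<Sum>(x, k)\<in>D - B. cmod (measure lborel k *\<^sub>R h' x - G k)) \<le> (\<Sum>(x, k)\<in>D - B. e' * measure lborel k)"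
      proof (rule sum_mono, clarify)
        fix x k assume xk: "(x, k) \<in> D" "(x, k) \<notin> B"
        then have "x \<notin> N" by (auto simp: B_def)
        obtain u v where uv: "k = {u..v}" "u \<le> x" "x \<le> v" "a \<le> u" "v \<le> c" using kform[OF xk(1)] by blast
        have "u \<in> ball x (\<rho> x)" "v \<in> ball x (\<rho> x)"
          using subsetD[OF fine[OF xk(1)], of u] subsetD[OF fine[OF xk(1)], of v] uv by simp_all
        then have "cmod (g u - g x - (u - x) *\<^sub>R h x) \<le> e' * \<bar>u - x\<bar>" "cmod (g v - g x - (v - x) *\<^sub>R h x) \<le> e' * \<bar>v - x\<bar>"
          using uv \<open>x \<notin> N\<close> \<rho>(3)[of x u] \<rho>(3)[of x v] by (simp_all add: dist_real_def abs_minus_commute)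
        moreover have "measure lborel k *\<^sub>R h' x - G k = (g u - g x - (u - x) *\<^sub>R h x) - (g v - g x - (v - x) *\<^sub>R h x)"
          using uv \<open>x \<notin> N\<close> by (simp add: h'_def G_def algebra_simps)
        ultimately have "cmod (measure lborel k *\<^sub>R h' x - G k) \<le> e' * \<bar>u - x\<bar> + e' * \<bar>v - x\<bar>"
          by (simp only:) (rule order_trans[OF norm_triangle_ineq4 add_mono])
        also have "\<dots> = e' * measure lborel k" using uv by (simp add: algebra_simps)
        finally show "cmod (measure lborel k *\<^sub>R h' x - G k) \<le> e' * measure lborel k" .
      qed
      have "(\<Sum>(x, k)\<in>D. measure lborel k *\<^sub>R h' x) - (g c - g a) = (\<Sum>(x, k)\<in>D. measure lborel k *\<^sub>R h' x - G k)"
        using additive_tagged_division_1[OF \<open>a \<le> c\<close> D, of g]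
        by (simp add: G_def sum_subtractf case_prod_unfold)
      also have "\<dots> = (\<Sum>(x, k)\<in>D - B. measure lborel k *\<^sub>R h' x - G k) + (\<Sum>(x, k)\<in>B. measure lborel k *\<^sub>R h' x - G k)"
        by (rule sum.subset_diff[OF BD(1) Dd(1)])
      also have "(\<Sum>(x, k)\<in>B. measure lborel k *\<^sub>R h' x - G k) = (\<Sum>(x, k)\<in>B. - G k)"
        by (intro sum.cong) (auto simp: B_def h'_def)
      also have "norm ((\<Sum>(x, k)\<in>D - B. measure lborel k *\<^sub>R h' x - G k) + (\<Sum>(x, k)\<in>B. - G k)) \<le>
          (\<Sum>(x, k)\<in>D - B. cmod (measure lborel k *\<^sub>R h' x - G k)) + (\<Sum>(x, k)\<in>B. cmod (G k))"
        by (rule norm_triangle_mono; rule order_trans[OF norm_sum]; rule sum_mono) auto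
      also have "(\<Sum>(x, k)\<in>D - B. cmod (measure lborel k *\<^sub>R h' x - G k)) \<le> e' * (\<Sum>(x, k)\<in>D. measure lborel k)"
      proof -
        have "(\<Sum>(x, k)\<in>D - B. e' * measure lborel k) \<le> (\<Sum>(x, k)\<in>D. e' * measure lborel k)"
          by (rule sum_mono2) (use Dd(1) e' in auto)
        then show ?thesis using good by (simp add: sum_distrib_left case_prod_unfold)
      qed
      also have "(\<Sum>(x, k)\<in>D. measure lborel k) = c - a"
        using additive_content_tagged_division[of D a c] D \<open>a \<le> c\<close> by (simp add: box_real)
      finally show "norm ((\<Sum>(x, k)\<in>D. measure lborel k *\<^sub>R h' x) - (g c - g a)) < e"
        using bad e'(2) by linarith
    qed
  qed
  then show ?thesis
    by (rule has_integral_spike[OF N, rotated]) (auto simp: h'_def)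
qed

section \<open>Energy on an interval\<close>

text \<open>Domain functions are absolutely continuous only on compact subintervals between nodes.
  The difference \<open>J\<close> of the indefinite integral and \<open>g\<close> is constant on the
  open interval and continuous up to the ends, hence constant on the closed interval.\<close>

lemma AC_on_has_integral_open:
  fixes g h :: "real \<Rightarrow> complex"
  assumes "u < v" and cont: "continuous_on {u..v} g"
    and ac: "\<And>s t. u < s \<Longrightarrow> s \<le> t \<Longrightarrow> t < v \<Longrightarrow> AC_on s t g"
    and N: "negligible N"
    and der: "\<And>t. t \<in> {u<..<v} - N \<Longrightarrow> (g has_vector_derivative h t) (at t)"
    and int: "h integrable_on {u..v}"
  shows "(h has_integral (g v - g u)) {u..v}"
proof -
  define J where "J t = integral {u..t} h - g t" for t
  have "continuous_on {u..v} J"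
    unfolding J_def by (intro continuous_intros indefinite_integral_continuous_1 int cont)
  then have contJ: "continuous_on (closure {u<..<v}) J"
    using \<open>u < v\<close> by simp
  have J_eq: "J t = J s" if "u < s" "s \<le> t" "t < v" for s t
  proof -
    have "(h has_integral (g t - g s)) {s..t}"
      by (rule AC_on_has_integral[OF ac[OF that] \<open>s \<le> t\<close> N])
        (use that in \<open>auto intro!: has_vector_derivative_at_within der\<close>)
    moreover have "integral {u..t} h = integral {u..s} h + integral {s..t} h"
      by (rule Henstock_Kurzweil_Integration.integral_combine[symmetric])
        (use that in \<open>auto intro: integrable_subinterval_real[OF int]\<close>)
    ultimately show ?thesis
      by (simp add: J_def integral_unique)
  qed
  define m where "m = (u + v) / 2"
  have "J t = J m" if "t \<in> {u<..<v}" for t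
    using J_eq[of t m] J_eq[of m t] that \<open>u < v\<close> by (cases "t \<le> m") (auto simp: m_def)
  then have "J u = J m" "J v = J m"
    using \<open>u < v\<close> by (auto intro: continuous_constant_on_closure[OF contJ])
  then have "integral {u..v} h = g v - g u"
    by (simp add: J_def algebra_simps)
  then show ?thesis
    using int by (simp add: has_integral_iff)
qed

text \<open>The fundamental theorem applied to f' times the conjugate of f, which is again locally
  absolutely continuous.\<close>

lemma integral_by_parts_interval:
  fixes f f' h :: "real \<Rightarrow> complex"
  assumes "u < v" and f: "continuous_on {u..v} f" and f': "continuous_on {u..v} f'"
    and acf: "\<And>s t. u < s \<Longrightarrow> s \<le> t \<Longrightarrow> t < v \<Longrightarrow> AC_on s t f"
    and acf': "\<And>s t. u < s \<Longrightarrow> s \<le> t \<Longrightarrow> t < v \<Longrightarrow> AC_on s t f'"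
    and df: "\<And>t. t \<in> {u<..<v} \<Longrightarrow> (f has_vector_derivative f' t) (at t)"
    and N: "negligible N"
    and df': "\<And>t. t \<in> {u<..<v} - N \<Longrightarrow> (f' has_vector_derivative h t) (at t)"
    and int: "(\<lambda>t. h t * cnj (f t)) integrable_on {u..v}"
  shows "integral {u..v} (\<lambda>t. h t * cnj (f t)) =
    f' v * cnj (f v) - f' u * cnj (f u) - of_real (integral {u..v} (\<lambda>t. (cmod (f' t))\<^sup>2))"
proof -
  have sq: "(\<lambda>t. (cmod (f' t))\<^sup>2) integrable_on {u..v}"
    by (intro integrable_continuous_interval continuous_intros f')
  have sq': "((\<lambda>t. f' t * cnj (f' t)) has_integral of_real (integral {u..v} (\<lambda>t. (cmod (f' t))\<^sup>2))) {u..v}"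
    using has_integral_of_real[OF integrable_integral[OF sq], where 'b=complex] by (simp only: complex_norm_square)
  have "((\<lambda>t. f' t * cnj (f' t) + h t * cnj (f t)) has_integral (f' v * cnj (f v) - f' u * cnj (f u))) {u..v}"
  proof (rule AC_on_has_integral_open[OF \<open>u < v\<close> _ _ N])
    show "continuous_on {u..v} (\<lambda>t. f' t * cnj (f t))"
      by (intro continuous_intros f f')
    show "AC_on s t (\<lambda>t. f' t * cnj (f t))" if "u < s" "s \<le> t" "t < v" for s t
      using that by (intro AC_on_mult AC_on_cnj acf acf')
    show "((\<lambda>t. f' t * cnj (f t)) has_vector_derivative f' t * cnj (f' t) + h t * cnj (f t)) (at t)"
      if "t \<in> {u<..<v} - N" for t
      using that df[of t] df'[of t] by (intro has_vector_derivative_mult has_vector_derivative_cnj) auto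
    show "(\<lambda>t. f' t * cnj (f' t) + h t * cnj (f t)) integrable_on {u..v}"
      using sq' int by (intro Henstock_Kurzweil_Integration.integrable_add) auto
  qed
  from has_integral_diff[OF this sq'] show ?thesis
    by (simp add: integral_unique)
qed

text \<open>
  With \<open>m\<close> the difference quotient of \<open>f\<close> and \<open>w(t) = \<kappa>(u + v - 2t)\<close> one integrates
  \<open>|f' - m + w f|\<^sup>2 \<ge> 0\<close>. The linear weight yields the boundary terms, and no lower bound on
  the length of the interval enters.
\<close>

lemma interval_energy_bound:
  fixes f f' :: "real \<Rightarrow> complex"
  assumes "u < v" and f: "continuous_on {u..v} f" and f': "continuous_on {u..v} f'"
    and df: "\<And>t. t \<in> {u<..<v} \<Longrightarrow> (f has_vector_derivative f' t) (at t)"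
    and "\<kappa> \<ge> 0"
  shows "(cmod (f v - f u))\<^sup>2 / (v - u) + \<kappa> / 2 * ((v - u) * ((cmod (f u))\<^sup>2 + (cmod (f v))\<^sup>2))
    \<le> integral {u..v} (\<lambda>t. (cmod (f' t))\<^sup>2)
      + (6 * \<kappa> + \<kappa>\<^sup>2 * (v - u)\<^sup>2) * integral {u..v} (\<lambda>t. (cmod (f t))\<^sup>2)"
proof -
  define D where "D = v - u"
  define m where "m = (f v - f u) /\<^sub>R D"
  define w where "w t = \<kappa> * (u + v - 2 * t)" for t
  have D: "D > 0" using \<open>u < v\<close> by (simp add: D_def)
  define F where "F = integral {u..v} (\<lambda>t. (cmod (f t))\<^sup>2)"
  define E where "E = integral {u..v} (\<lambda>t. (cmod (f' t))\<^sup>2)"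
  have hF: "((\<lambda>t. (cmod (f t))\<^sup>2) has_integral F) {u..v}"
    unfolding F_def by (intro integrable_integral integrable_continuous_interval continuous_intros f)
  have hE: "((\<lambda>t. (cmod (f' t))\<^sup>2) has_integral E) {u..v}"
    unfolding E_def by (intro integrable_integral integrable_continuous_interval continuous_intros f')
  have hB: "((\<lambda>t. - 2 * \<kappa> * (f t \<bullet> f t) + w t * (f t \<bullet> f' t + f' t \<bullet> f t)) has_integral
      w v * (f v \<bullet> f v) - w u * (f u \<bullet> f u)) {u..v}"
  proof (rule fundamental_theorem_of_calculus_interior)
    fix t assume "t \<in> {u<..<v}"
    then have "((\<lambda>t. f t \<bullet> f t) has_vector_derivative f t \<bullet> f' t + f' t \<bullet> f t) (at t)"
      by (intro bounded_bilinear.has_vector_derivative[OF bounded_bilinear_inner] df)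
    moreover have "(w has_vector_derivative - 2 * \<kappa>) (at t)"
      unfolding w_def has_real_derivative_iff_has_vector_derivative[symmetric]
      by (auto intro!: derivative_eq_intros)
    ultimately have "((\<lambda>t. w t * (f t \<bullet> f t)) has_vector_derivative
        w t * (f t \<bullet> f' t + f' t \<bullet> f t) + - 2 * \<kappa> * (f t \<bullet> f t)) (at t)"
      by (intro has_vector_derivative_mult)
    then show "((\<lambda>t. w t * (f t \<bullet> f t)) has_vector_derivative
        - 2 * \<kappa> * (f t \<bullet> f t) + w t * (f t \<bullet> f' t + f' t \<bullet> f t)) (at t)"
      by (simp add: add.commute)
  qed (use \<open>u < v\<close> in \<open>auto simp: w_def intro!: continuous_intros f\<close>)
  have hm: "((\<lambda>t. m \<bullet> f' t) has_integral m \<bullet> f v - m \<bullet> f u) {u..v}"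
    by (rule fundamental_theorem_of_calculus_interior)
      (use \<open>u < v\<close> df in \<open>auto intro!: continuous_intros f bounded_linear.has_vector_derivative[OF bounded_linear_inner_right]\<close>)
  have hc: "((\<lambda>t. (1 + \<kappa> * D\<^sup>2 / 4) * (cmod m)\<^sup>2) has_integral (v - u) *\<^sub>R ((1 + \<kappa> * D\<^sup>2 / 4) * (cmod m)\<^sup>2)) {u..v}"
    using has_integral_const_real[of "(1 + \<kappa> * D\<^sup>2 / 4) * (cmod m)\<^sup>2" u v] \<open>u < v\<close> by simp
  \<comment> \<open>A majorant of |f' - m + w f|^2 with computable integral. In the coefficient 6
    \<kappa>, 2 \<kappa> compensates the derivative of \<open>w\<close>, and 4 \<kappa> comes from
    Young's inequality for the cross term of \<open>m\<close> and \<open>w f\<close>, which also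
    yields \<kappa> D^2 / 4 at |m|^2; \<kappa>^2 D^2 bounds w^2.\<close>
  let ?R = "\<lambda>t. (cmod (f' t))\<^sup>2 - 2 * (m \<bullet> f' t)
      + (- 2 * \<kappa> * (f t \<bullet> f t) + w t * (f t \<bullet> f' t + f' t \<bullet> f t))
      + (6 * \<kappa> + \<kappa>\<^sup>2 * D\<^sup>2) * (cmod (f t))\<^sup>2 + (1 + \<kappa> * D\<^sup>2 / 4) * (cmod m)\<^sup>2"
  have "(?R has_integral E - 2 * (m \<bullet> f v - m \<bullet> f u) + (w v * (f v \<bullet> f v) - w u * (f u \<bullet> f u))
      + (6 * \<kappa> + \<kappa>\<^sup>2 * D\<^sup>2) * F + (v - u) *\<^sub>R ((1 + \<kappa> * D\<^sup>2 / 4) * (cmod m)\<^sup>2)) {u..v}"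
    by (intro has_integral_add has_integral_diff has_integral_mult_right hF hE hB hm hc)
  moreover have "?R t \<ge> 0" if "t \<in> {u..v}" for t
  proof -
    have w: "\<bar>w t\<bar> \<le> \<kappa> * D"
      using that \<open>\<kappa> \<ge> 0\<close> unfolding w_def D_def abs_mult by (intro mult_mono) auto
    then have w2: "(w t)\<^sup>2 \<le> \<kappa>\<^sup>2 * D\<^sup>2"
      using power_mono[OF w, of 2] by (simp add: power_mult_distrib)
    have "\<bar>2 * w t * (m \<bullet> f t)\<bar> \<le> 2 * ((\<kappa> * D) * (cmod m * cmod (f t)))"
      using mult_mono[OF w Cauchy_Schwarz_ineq2[of m "f t"]] \<open>\<kappa> \<ge> 0\<close> D by (simp add: abs_mult)
    \<comment> \<open>Young's inequality, weighted so that the coefficient of |m|^2 is only D^2 /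
      4.\<close>
    also have "\<dots> \<le> \<kappa> * (D\<^sup>2 * (cmod m)\<^sup>2 / 4 + 4 * (cmod (f t))\<^sup>2)"
    proof -
      have "0 \<le> \<kappa> * (D * cmod m / 2 - 2 * cmod (f t))\<^sup>2" using \<open>\<kappa> \<ge> 0\<close> by simp
      then show ?thesis by (simp add: power2_eq_square algebra_simps)
    qed
    finally have cross: "2 * w t * (m \<bullet> f t) \<le> \<kappa> * (D\<^sup>2 * (cmod m)\<^sup>2 / 4 + 4 * (cmod (f t))\<^sup>2)"
      by linarith
    have "0 \<le> (cmod (f' t - m + w t *\<^sub>R f t))\<^sup>2" by simp
    also have "\<dots> = (cmod (f' t))\<^sup>2 - 2 * (m \<bullet> f' t) + (cmod m)\<^sup>2 + 2 * w t * (f t \<bullet> f' t)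
        - 2 * w t * (m \<bullet> f t) + (w t)\<^sup>2 * (cmod (f t))\<^sup>2"
      unfolding power2_norm_eq_inner
      by (simp add: inner_add_left inner_add_right inner_diff_left inner_diff_right inner_commute power2_eq_square algebra_simps)
    finally show ?thesis
      using cross mult_right_mono[OF w2, of "(cmod (f t))\<^sup>2"] D
        abs_ge_minus_self[of "2 * w t * (m \<bullet> f t)"]
        \<open>\<bar>2 * w t * (m \<bullet> f t)\<bar> \<le> 2 * ((\<kappa> * D) * (cmod m * cmod (f t)))\<close>
        \<open>2 * ((\<kappa> * D) * (cmod m * cmod (f t))) \<le> \<kappa> * (D\<^sup>2 * (cmod m)\<^sup>2 / 4 + 4 * (cmod (f t))\<^sup>2)\<close>
      by (simp add: power2_norm_eq_inner inner_commute algebra_simps)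
  qed
  ultimately have "0 \<le> E - 2 * (m \<bullet> f v - m \<bullet> f u) + (w v * (f v \<bullet> f v) - w u * (f u \<bullet> f u))
      + (6 * \<kappa> + \<kappa>\<^sup>2 * D\<^sup>2) * F + (v - u) *\<^sub>R ((1 + \<kappa> * D\<^sup>2 / 4) * (cmod m)\<^sup>2)"
    by (rule has_integral_nonneg)
  moreover have "m \<bullet> f v - m \<bullet> f u = (cmod (f v - f u))\<^sup>2 / D"
    by (simp add: m_def power2_norm_eq_inner divide_inverse inner_diff_right algebra_simps)
  moreover have "(v - u) *\<^sub>R ((1 + \<kappa> * D\<^sup>2 / 4) * (cmod m)\<^sup>2) =
      (cmod (f v - f u))\<^sup>2 / D + \<kappa> * D * (cmod (f v - f u))\<^sup>2 / 4"
  proof -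
    have "(cmod m)\<^sup>2 = (cmod (f v - f u))\<^sup>2 / D\<^sup>2"
      using D unfolding m_def norm_scaleR by (simp add: power_mult_distrib divide_inverse power_inverse)
    then show ?thesis
      using D unfolding D_def[symmetric] by (simp only:) (simp add: power2_eq_square field_simps)
  qed
  \<comment> \<open>By the parallelogram law, a quarter of the left side costs half of the boundary
    term - \<kappa> D (|f(u)|^2 + |f(v)|^2) produced by \<open>w\<close>; the other half is the mass
    term of the claim.\<close>
  moreover have "\<kappa> * D * (cmod (f v - f u))\<^sup>2 \<le> \<kappa> * D * (2 * (cmod (f u))\<^sup>2 + 2 * (cmod (f v))\<^sup>2)"
  proof (rule mult_left_mono)
    have "(cmod (f v - f u))\<^sup>2 + (cmod (f v + f u))\<^sup>2 = 2 * (cmod (f u))\<^sup>2 + 2 * (cmod (f v))\<^sup>2"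
      unfolding power2_norm_eq_inner by (simp add: inner_add_left inner_add_right inner_diff_left inner_diff_right)
    then show "(cmod (f v - f u))\<^sup>2 \<le> 2 * (cmod (f u))\<^sup>2 + 2 * (cmod (f v))\<^sup>2"
      using zero_le_power2[of "cmod (f v + f u)"] by linarith
  qed (use D \<open>\<kappa> \<ge> 0\<close> in auto)
  moreover have "w v * (f v \<bullet> f v) - w u * (f u \<bullet> f u) = - (\<kappa> * D * ((cmod (f u))\<^sup>2 + (cmod (f v))\<^sup>2))"
    by (simp add: w_def D_def power2_norm_eq_inner algebra_simps)
  ultimately show ?thesis
    unfolding D_def[symmetric] E_def[symmetric] F_def[symmetric] by (simp add: algebra_simps)
qed

section \<open>From continuity on closed intervals to one-sided limits at the ends\<close>

lemma AC_on_cong: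
  assumes "\<And>t. t \<in> {a..c} \<Longrightarrow> f t = g t" and "AC_on a c f"
  shows "AC_on a c g"
  unfolding AC_on_iff
proof (intro allI impI)
  fix e :: real assume "e > 0"
  then obtain \<delta> where "\<delta> > 0" and \<delta>: "\<And>P. interval_family a c P \<Longrightarrow>
     (\<Sum>(u, v)\<in>P. v - u) < \<delta> \<Longrightarrow> (\<Sum>(u, v)\<in>P. cmod (f v - f u)) < e"
    using assms(2) unfolding AC_on_iff by blast
  have "(\<Sum>(u, v)\<in>P. cmod (g v - g u)) = (\<Sum>(u, v)\<in>P. cmod (f v - f u))" if "interval_family a c P" for P
    using that by (intro sum.cong refl) (fastforce simp: interval_family_def assms(1))
  with \<open>\<delta> > 0\<close> \<delta> show "\<exists>\<delta>>0. \<forall>P. interval_family a c P \<longrightarrow>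
     (\<Sum>(u, v)\<in>P. v - u) < \<delta> \<longrightarrow> (\<Sum>(u, v)\<in>P. cmod (g v - g u)) < e"
    by metis
qed

text \<open>Domain functions have arbitrary values at the nodes and only their one-sided limits
  matter; overwriting the end values by these limits gives functions continuous on the closed
  interval.\<close>

definition extend_Icc :: "real \<Rightarrow> real \<Rightarrow> 'a \<Rightarrow> 'a \<Rightarrow> (real \<Rightarrow> 'a) \<Rightarrow> real \<Rightarrow> 'a" where
  "extend_Icc u v a c f t = (if t \<le> u then a else if v \<le> t then c else f t)"

lemma extend_Icc_simps [simp]:
  "u < v \<Longrightarrow> extend_Icc u v a c f u = a"
  "u < v \<Longrightarrow> extend_Icc u v a c f v = c"
  "u < t \<Longrightarrow> t < v \<Longrightarrow> extend_Icc u v a c f t = f t"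
  by (auto simp: extend_Icc_def)

lemma continuous_on_extend_Icc:
  fixes f :: "real \<Rightarrow> 'a::topological_space"
  assumes "u < v" and f: "continuous_on {u<..<v} f"
    and lims: "(f \<longlongrightarrow> a) (at_right u)" "(f \<longlongrightarrow> c) (at_left v)"
  shows "continuous_on {u..v} (extend_Icc u v a c f)"
proof (rule continuous_on_IccI)
  show "(extend_Icc u v a c f \<longlongrightarrow> extend_Icc u v a c f u) (at_right u)"
    unfolding extend_Icc_simps(1)[OF \<open>u < v\<close>]
    by (rule Lim_transform_eventually[OF lims(1)], rule eventually_at_rightI[OF _ \<open>u < v\<close>]) simp
  show "(extend_Icc u v a c f \<longlongrightarrow> extend_Icc u v a c f v) (at_left v)"
    unfolding extend_Icc_simps(2)[OF \<open>u < v\<close>]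
    by (rule Lim_transform_eventually[OF lims(2)], rule eventually_at_leftI[OF _ \<open>u < v\<close>]) simp
  show "extend_Icc u v a c f \<midarrow>t\<rightarrow> extend_Icc u v a c f t" if "u < t" "t < v" for t
  proof (rule Lim_transform_within_open[of f])
    show "f \<midarrow>t\<rightarrow> extend_Icc u v a c f t"
      using f that by (simp add: continuous_on_eq_continuous_at isCont_def)
  qed (use that in \<open>auto intro: open_greaterThanLessThan\<close>)
qed (use \<open>u < v\<close> in auto)

lemma has_vector_derivative_extend_Icc:
  assumes "(f has_vector_derivative D) (at t)" "u < t" "t < v"
  shows "(extend_Icc u v a c f has_vector_derivative D) (at t)"
  by (rule has_vector_derivative_transform_within_open[OF assms(1), of "{u<..<v}"])
    (use assms in auto)

lemma integral_spike_Icc: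
  fixes f g :: "real \<Rightarrow> 'a::banach"
  assumes "\<And>t. u < t \<Longrightarrow> t < v \<Longrightarrow> f t = g t"
  shows "integral {u..v} f = integral {u..v} g"
  by (rule integral_spike[of "{u, v}"]) (use assms in auto)

text \<open>Both conclusions are proved for the continuous extensions of \<open>f\<close> and
  \<open>f'\<close>; altering the integrands at the two end points does not change the
  integrals.\<close>

lemma interval_form:
  fixes f f' h :: "real \<Rightarrow> complex"
  assumes "u < v"
    and acf: "\<And>s t. u < s \<Longrightarrow> s \<le> t \<Longrightarrow> t < v \<Longrightarrow> AC_on s t f"
    and acf': "\<And>s t. u < s \<Longrightarrow> s \<le> t \<Longrightarrow> t < v \<Longrightarrow> AC_on s t f'"
    and df: "\<And>t. u < t \<Longrightarrow> t < v \<Longrightarrow> (f has_vector_derivative f' t) (at t)"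
    and N: "negligible N"
    and df': "\<And>t. u < t \<Longrightarrow> t < v \<Longrightarrow> t \<notin> N \<Longrightarrow> (f' has_vector_derivative h t) (at t)"
    and int: "(\<lambda>t. h t * cnj (f t)) integrable_on {u..v}"
    and lims: "(f \<longlongrightarrow> a) (at_right u)" "(f \<longlongrightarrow> c) (at_left v)"
      "(f' \<longlongrightarrow> p) (at_right u)" "(f' \<longlongrightarrow> q) (at_left v)"
  shows "integral {u..v} (\<lambda>t. h t * cnj (f t)) =
      q * cnj c - p * cnj a - of_real (integral {u..v} (\<lambda>t. (cmod (f' t))\<^sup>2))" (is ?parts)
    and "\<kappa> \<ge> 0 \<Longrightarrow> (cmod (c - a))\<^sup>2 / (v - u) + \<kappa> / 2 * ((v - u) * ((cmod a)\<^sup>2 + (cmod c)\<^sup>2))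
      \<le> integral {u..v} (\<lambda>t. (cmod (f' t))\<^sup>2)
        + (6 * \<kappa> + \<kappa>\<^sup>2 * (v - u)\<^sup>2) * integral {u..v} (\<lambda>t. (cmod (f t))\<^sup>2)" (is "_ \<Longrightarrow> ?bound")
proof -
  let ?f = "extend_Icc u v a c f" and ?f' = "extend_Icc u v p q f'"
  have contf: "continuous_on {u<..<v} f"
    by (rule continuous_at_imp_continuous_on) (auto intro!: has_vector_derivative_continuous df)
  \<comment> \<open>Since \<open>f'\<close> need not be differentiable everywhere, its continuity
    comes from absolute continuity on a compact neighbourhood of each point.\<close>
  have contf': "continuous_on {u<..<v} f'"
  proof (rule continuous_at_imp_continuous_on, intro ballI)
    fix t assume t: "t \<in> {u<..<v}"
    define s e where "s = (u + t) / 2" and "e = (t + v) / 2"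
    have "continuous_on {s..e} f'"
      using t by (intro AC_on_imp_continuous_on acf') (auto simp: s_def e_def)
    moreover have "t \<in> interior {s..e}" using t by (auto simp: s_def e_def)
    ultimately show "isCont f' t" by (rule continuous_on_interior)
  qed
  have cont: "continuous_on {u..v} ?f" "continuous_on {u..v} ?f'"
    by (intro continuous_on_extend_Icc \<open>u < v\<close> contf contf' lims)+
  have der: "(?f has_vector_derivative ?f' t) (at t)" if "t \<in> {u<..<v}" for t
    using has_vector_derivative_extend_Icc[OF df[of t], of u v a c] that by simp
  have sq: "integral {u..v} (\<lambda>t. (cmod (?f' t))\<^sup>2) = integral {u..v} (\<lambda>t. (cmod (f' t))\<^sup>2)"
    "integral {u..v} (\<lambda>t. (cmod (?f t))\<^sup>2) = integral {u..v} (\<lambda>t. (cmod (f t))\<^sup>2)"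
    by (rule integral_spike_Icc; simp)+
  have "integral {u..v} (\<lambda>t. h t * cnj (?f t)) =
    ?f' v * cnj (?f v) - ?f' u * cnj (?f u) - of_real (integral {u..v} (\<lambda>t. (cmod (?f' t))\<^sup>2))"
  proof (rule integral_by_parts_interval[OF \<open>u < v\<close> cont _ _ der N])
    show "AC_on s t ?f" "AC_on s t ?f'" if "u < s" "s \<le> t" "t < v" for s t
      using that by (auto intro: AC_on_cong[OF _ acf] AC_on_cong[OF _ acf'])
    show "(?f' has_vector_derivative h t) (at t)" if "t \<in> {u<..<v} - N" for t
      using that by (intro has_vector_derivative_extend_Icc df') auto
    show "(\<lambda>t. h t * cnj (?f t)) integrable_on {u..v}"
      by (rule integrable_spike[OF int, of "{u, v}"]) auto
  qed
  moreover have "integral {u..v} (\<lambda>t. h t * cnj (?f t)) = integral {u..v} (\<lambda>t. h t * cnj (f t))"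
    by (rule integral_spike_Icc) simp
  ultimately show ?parts
    using \<open>u < v\<close> by (simp add: sq)
  show ?bound if "\<kappa> \<ge> 0"
    using interval_energy_bound[OF \<open>u < v\<close> cont der that] \<open>u < v\<close> by (simp add: sq)
qed

section \<open>The form of the Hamiltonian\<close>

locale node_sequence =
  fixes b :: ereal and x :: "nat \<Rightarrow> real"
  assumes x_0: "x 0 = 0" and strict_mono_x: "strict_mono x" and x_less: "\<And>n. ereal (x n) < b"
    and x_lim: "(\<lambda>n. ereal (x n)) \<longlonglongrightarrow> b"
begin

abbreviation I :: "real set" where "I \<equiv> half_open b"
abbreviation X :: "real set" where "X \<equiv> x ` {1..}"

lemma x_Suc: "x n < x (n + 1)"
  using strict_mono_x by (simp add: strict_mono_Suc_iff)

lemma x_nonneg: "0 \<le> x n"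
  using strict_mono_less_eq[OF strict_mono_x, of 0 n] x_0 by simp

lemma Icc_subset_I: "{0..x n} \<subseteq> I"
proof
  fix t assume "t \<in> {0..x n}"
  then have "0 \<le> t" "ereal t \<le> ereal (x n)" by auto
  then show "t \<in> I" using le_less_trans[OF \<open>ereal t \<le> ereal (x n)\<close> x_less] by (simp add: half_open_def)
qed

lemma interval_unique:
  assumes "x n \<le> t" "t < x (n + 1)" "x m \<le> t" "t < x (m + 1)"
  shows "n = m"
proof -
  have "n < m + 1" "m < n + 1"
    using le_less_trans[OF assms(1,4)] le_less_trans[OF assms(3,2)] strict_mono_less[OF strict_mono_x] by blast+
  then show ?thesis by simp
qed

lemma interval_cover:
  assumes "t \<in> I"
  obtains n where "x n \<le> t" "t < x (n + 1)"
proof -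
  have "\<forall>\<^sub>F n in sequentially. ereal t < ereal (x n)"
    using assms by (intro order_tendstoD(1)[OF x_lim]) (simp add: half_open_def)
  then have ex: "\<exists>n. t < x n"
    by (auto simp: eventually_sequentially)
  define m where "m = (LEAST n. t < x n)"
  have m: "t < x m" and least: "\<And>k. k < m \<Longrightarrow> x k \<le> t"
    unfolding m_def using LeastI_ex[OF ex] not_less_Least[of _ "\<lambda>n. t < x n"] leI by blast+
  have "0 \<le> t" using assms by (simp add: half_open_def)
  then have "m \<noteq> 0" using m x_0 by (metis not_less)
  then obtain k where "m = k + 1" by (metis Suc_eq_plus1 not0_implies_Suc)
  then show ?thesis using that[of k] m least[of k] by simp
qed

lemma interval_subset: "{x n<..<x (n + 1)} \<subseteq> I - X"
proof
  fix t assume t: "t \<in> {x n<..<x (n + 1)}"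
  then have "t \<in> I" using subsetD[OF Icc_subset_I, of t "n + 1"] x_nonneg[of n] by simp
  moreover have "t \<notin> X"
  proof
    assume "t \<in> X"
    then obtain m where "t = x m" by blast
    then show False using t interval_unique[of n t m] x_Suc[of m] by simp
  qed
  ultimately show "t \<in> I - X" by blast
qed

lemma first_interval_subset: "{0..<x 1} \<subseteq> I - X"
proof
  fix t assume t: "t \<in> {0..<x 1}"
  show "t \<in> I - X"
  proof (cases "t = 0")
    case True
    have "0 < x m" if "m \<ge> 1" for m
      using strict_monoD[OF strict_mono_x, of 0 m] that x_0 by simp
    then have "0 \<notin> X" by (metis atLeast_iff imageE less_irrefl)
    moreover have "0 \<in> I" using Icc_subset_I[of 0] x_0 by auto
    ultimately show ?thesis using True by simp
  next
    case False
    then have "t \<in> {x 0<..<x (0 + 1)}" using t x_0 by auto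
    then show ?thesis using interval_subset[of 0] by blast
  qed
qed

lemma at_within_interval:
  assumes "x n < t" "t < x (n + 1)"
  shows "at t within (I - X) = at t"
  by (rule at_within_open_subset[OF _ open_greaterThanLessThan interval_subset]) (use assms in auto)

text \<open>This makes the derivative within \<open>I - X\<close> at 0 a right derivative, so the
  condition f'(0) = 0 is one-sided.\<close>

lemma at_within_zero: "at 0 within (I - X) = at_right 0"
proof (rule at_within_nhd)
  show "0 \<in> {..<x 1}" using x_Suc[of 0] x_0 by simp
  show "(I - X) \<inter> {..<x 1} - {0} = {0<..} \<inter> {..<x 1} - {0}"
  proof (rule set_eqI)
    fix t
    have "t \<in> I - X \<longleftrightarrow> 0 \<le> t" if "t < x 1"
    proof
      show "t \<in> I - X" if "0 \<le> t"
        using subsetD[OF first_interval_subset, of t] that \<open>t < x 1\<close> by simp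
    qed (simp add: half_open_def)
    then show "t \<in> (I - X) \<inter> {..<x 1} - {0} \<longleftrightarrow> t \<in> {0<..} \<inter> {..<x 1} - {0}"
      unfolding Int_iff Diff_iff[of t "_ \<inter> _"] by (cases "t < x 1") (simp_all only: lessThan_iff greaterThan_iff, auto)
  qed
qed simp

lemma I_lebesgue: "I \<in> sets lebesgue"
proof -
  have "I = {0..} \<inter> ereal -` {..<b}" by (auto simp: half_open_def)
  moreover have "open (ereal -` {..<b})"
    by (rule open_vimage[OF open_lessThan continuous_on_ereal[OF continuous_on_id]])
  then have "ereal -` {..<b} \<in> sets borel" by (rule borel_open)
  ultimately have "I \<in> sets borel" by (simp only:) (rule sets.Int, auto)
  then show ?thesis by simp
qed

lemma negligible_X: "negligible X"
  unfolding negligible_iff_null_sets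
  by (rule null_sets_completionI, rule countable_imp_null_set_lborel) simp

text \<open>Values on the null set \<open>X\<close> are unrestricted, so beyond \<open>x N\<close>
  the integrand vanishes almost everywhere. The Lebesgue integral over \<open>I\<close> thus becomes
  a finite sum of gauge integrals, to which the interval lemmas apply.\<close>

lemma integral_split:
  fixes \<phi> :: "real \<Rightarrow> 'a::euclidean_space"
  assumes int: "integrable (lebesgue_on I) \<phi>"
    and zero: "\<And>t. t \<in> I - X \<Longrightarrow> x N < t \<Longrightarrow> \<phi> t = 0"
  shows "integral\<^sup>L (lebesgue_on I) \<phi> = (\<Sum>n<N. integral {x n..x (n + 1)} \<phi>)"
    and "\<phi> integrable_on {x n..x (n + 1)}"
proof -
  have I: "\<phi> integrable_on I"
    using has_integral_integral_lebesgue_on[OF int I_lebesgue] by blast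
  have sub: "\<phi> integrable_on {x 0..x n}" for n
  proof -
    have "\<phi> absolutely_integrable_on I"
      using int I_lebesgue by (simp add: set_integrable_def integrable_restrict_space)
    then have "\<phi> absolutely_integrable_on {x 0..x n}"
      by (rule set_integrable_subset) (use Icc_subset_I x_0 in auto)
    then show ?thesis by (rule set_lebesgue_integral_eq_integral(1))
  qed
  have mono: "x n \<le> x m" if "n \<le> m" for n m
    using that strict_mono_x by (simp add: strict_mono_less_eq)
  show *: "\<phi> integrable_on {x n..x (n + 1)}" for n
    by (rule integrable_subinterval_real[OF sub[of "n + 1"]]) (use mono[of 0 n] in auto)
  have comb: "integral {x 0..x n} \<phi> = (\<Sum>k<n. integral {x k..x (k + 1)} \<phi>)" for n
  proof (induction n)
    case (Suc n)
    have "integral {x 0..x (n + 1)} \<phi> = integral {x 0..x n} \<phi> + integral {x n..x (n + 1)} \<phi>"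
      by (rule Henstock_Kurzweil_Integration.integral_combine[symmetric])
        (use mono[of 0 n] mono[of n "n + 1"] sub in auto)
    then show ?case using Suc by simp
  qed simp
  have "integral\<^sup>L (lebesgue_on I) \<phi> = integral I \<phi>"
    by (rule lebesgue_integral_eq_integral[OF int I_lebesgue])
  also have "\<dots> = integral I (\<lambda>t. if t \<in> {0..x N} then \<phi> t else 0)"
    by (rule integral_spike[OF negligible_X]) (use zero in \<open>auto simp: half_open_def\<close>)
  also have "\<dots> = integral {0..x N} \<phi>"
    using integral_restrict_Int[of I "{0..x N}" \<phi>] unfolding Int_absorb2[OF Icc_subset_I] .
  finally show "integral\<^sup>L (lebesgue_on I) \<phi> = (\<Sum>n<N. integral {x n..x (n + 1)} \<phi>)"
    using comb[of N] by (simp add: x_0)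
qed

text \<open>A compact subset of [0, b) has a largest point, which is below b and therefore below
  some node.\<close>

lemma W22_comp_support:
  assumes "f \<in> W22_comp I X"
  obtains N where "N \<ge> 1" "\<And>t. t \<in> I - X \<Longrightarrow> x N < t \<Longrightarrow> f t = 0"
proof -
  let ?K = "I \<inter> closure {t \<in> I - X. f t \<noteq> 0}"
  have K: "compact ?K" using assms by (simp add: W22_comp_def)
  have sub: "t \<in> ?K" if "t \<in> I - X" "f t \<noteq> 0" for t
    using that subsetD[OF closure_subset, of t "{t \<in> I - X. f t \<noteq> 0}"] by simp
  show ?thesis
  proof (cases "?K = {}")
    case True
    then have "f t = 0" if "t \<in> I - X" for t using sub[of t] that by blast
    then show ?thesis using that[of 1] by simp
  next
    case False
    then obtain m where m: "m \<in> ?K" "\<And>t. t \<in> ?K \<Longrightarrow> t \<le> m"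
      using compact_attains_sup[OF K] by blast
    have "m \<in> I" using m(1) by simp
    then obtain n where n: "x n \<le> m" "m < x (n + 1)"
      by (rule interval_cover)
    show ?thesis
    proof (rule that[of "n + 1"])
      fix t assume "t \<in> I - X" "x (n + 1) < t"
      then show "f t = 0" using sub[of t] m(2)[of t] n(2) by linarith
    qed simp
  qed
qed

end

text \<open>Regroups boundary terms of intervals, \<open>A\<close> at left ends and \<open>B\<close>
  at right ends, into differences at the common nodes.\<close>

lemma sum_shift_diff:
  fixes A B :: "nat \<Rightarrow> 'a::ab_group_add"
  assumes "N \<ge> 1" "A 0 = 0" "B N = 0"
  shows "(\<Sum>n<N. A n - B (n + 1)) = (\<Sum>n=1..<N. A n - B n)"
proof -
  have "(\<Sum>n<N. A n) = (\<Sum>n=1..<N. A n)"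
    by (rule sum.mono_neutral_right) (use assms in \<open>auto simp: not_le\<close>)
  moreover have "(\<Sum>n<N. B (n + 1)) = (\<Sum>n=1..<N. B n)"
  proof -
    have "(\<Sum>n<N. B (n + 1)) = (\<Sum>n=1..<N + 1. B n)"
      using sum.shift_bounds_Suc_ivl[of B 0 N] by (simp add: atLeast0LessThan)
    also have "\<dots> = (\<Sum>n=1..<N. B n)"
      using assms by simp
    finally show ?thesis .
  qed
  ultimately show ?thesis by (simp add: sum_subtractf)
qed

section \<open>Green's formula for the Hamiltonian and the lower bound\<close>

context node_sequence
begin

abbreviation D1 :: "(real \<Rightarrow> complex) \<Rightarrow> real \<Rightarrow> complex" where "D1 \<equiv> deriv_within (I - X)"

text \<open>The point 0 belongs to \<open>I - X\<close>, so absolute continuity reaches up to it;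
  this supplies the traces of \<open>f\<close> and f' at the left end.\<close>

lemma AC_loc_tendsto_zero:
  assumes "AC_loc (I - X) g"
  shows "(g \<longlongrightarrow> g 0) (at_right 0)"
proof -
  have x1: "0 < x 1" using x_Suc[of 0] x_0 by simp
  have "{0..x 1 / 2} \<subseteq> I - X"
    using x1 by (intro subset_trans[OF _ first_interval_subset]) auto
  then have "continuous_on {0..x 1 / 2} g"
    using assms x1 by (intro AC_on_imp_continuous_on) (simp add: AC_loc_def)
  then have "(g \<longlongrightarrow> g 0) (at 0 within {0..x 1 / 2})"
    using x1 by (simp add: continuous_on_def)
  then show ?thesis using x1 by (simp add: at_within_Icc_at_right)
qed

text \<open>Green's formula on every node interval: in the sum the boundary terms combine to the
  jumps of f', which the interface conditions turn into \<alpha>_n |y_n|^2. Here \<open>y\<close> is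
  the trace of \<open>f\<close>; the limit clause identifies it for a concrete \<open>f\<close>, and
  the last clause carries over the energy bound.\<close>

lemma H_dom_form:
  assumes f: "f \<in> H_dom b x \<alpha>"
    and N: "N \<ge> 1" "\<forall>t\<in>I - X. x N < t \<longrightarrow> f t = 0"
  obtains y where "\<And>n. n \<ge> N \<Longrightarrow> y n = 0"
    and "\<And>n. n \<ge> 1 \<Longrightarrow> (f \<longlongrightarrow> y n) (at_right (x n))"
    and "L2_inner (lebesgue_on I) (\<lambda>t. - D1 (D1 f) t) f = of_real
      ((\<Sum>n<N. integral {x n..x (n + 1)} (\<lambda>t. (cmod (D1 f t))\<^sup>2)) + (\<Sum>n=1..<N. \<alpha> n * (cmod (y n))\<^sup>2))"
    and "(L2_norm (lebesgue_on I) f)\<^sup>2 = (\<Sum>n<N. integral {x n..x (n + 1)} (\<lambda>t. (cmod (f t))\<^sup>2))"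
    and "\<And>n \<kappa>. \<kappa> \<ge> 0 \<Longrightarrow> (cmod (y (n + 1) - y n))\<^sup>2 / (x (n + 1) - x n)
      + \<kappa> / 2 * ((x (n + 1) - x n) * ((cmod (y n))\<^sup>2 + (cmod (y (n + 1)))\<^sup>2))
      \<le> integral {x n..x (n + 1)} (\<lambda>t. (cmod (D1 f t))\<^sup>2)
        + (6 * \<kappa> + \<kappa>\<^sup>2 * (x (n + 1) - x n)\<^sup>2) * integral {x n..x (n + 1)} (\<lambda>t. (cmod (f t))\<^sup>2)"
proof -
  note N = N(1) N(2)[rule_format]
  have f_W22: "f \<in> W22 I X" and f'0: "D1 f 0 = 0"
    and vpq: "\<forall>n\<ge>1. \<exists>v p q.
      (f \<longlongrightarrow> v) (at_right (x n)) \<and> (f \<longlongrightarrow> v) (at_left (x n)) \<and>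
      (D1 f \<longlongrightarrow> p) (at_right (x n)) \<and> (D1 f \<longlongrightarrow> q) (at_left (x n)) \<and>
      p - q = complex_of_real (\<alpha> n) * v"
    using f unfolding H_dom_def W22_comp_def Let_def by auto
  from f_W22 have f_L2: "f \<in> L2_space (lebesgue_on I)" and acf: "AC_loc (I - X) f" and df: "f differentiable_on (I - X)"
    and acf': "AC_loc (I - X) (D1 f)"
    and df': "AE t in lebesgue_on I. D1 f differentiable (at t within I - X)"
    and f''_L2: "D1 (D1 f) \<in> L2_space (lebesgue_on I)"
    unfolding W22_def Let_def by auto
  obtain v p q where v: "\<And>n. n \<ge> 1 \<Longrightarrow> (f \<longlongrightarrow> v n) (at_right (x n))" "\<And>n. n \<ge> 1 \<Longrightarrow> (f \<longlongrightarrow> v n) (at_left (x n))"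
    and p: "\<And>n. n \<ge> 1 \<Longrightarrow> (D1 f \<longlongrightarrow> p n) (at_right (x n))"
    and q: "\<And>n. n \<ge> 1 \<Longrightarrow> (D1 f \<longlongrightarrow> q n) (at_left (x n))"
    and jump: "\<And>n. n \<ge> 1 \<Longrightarrow> p n - q n = complex_of_real (\<alpha> n) * v n"
    using vpq by metis
  define y where "y n = (if n = 0 then f 0 else v n)" for n
  \<comment> \<open>\<open>P 0\<close> is f'(0) = 0, so the left end of the first interval
    contributes no boundary term, whereas \<open>y 0 = f 0\<close> stays free.\<close>
  define P where "P n = (if n = 0 then 0 else p n)" for n
  have y_right: "(f \<longlongrightarrow> y n) (at_right (x n))" for n
    using v(1)[of n] AC_loc_tendsto_zero[OF acf] x_0 by (cases "n = 0") (auto simp: y_def)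
  have P_right: "(D1 f \<longlongrightarrow> P n) (at_right (x n))" for n
    using p[of n] AC_loc_tendsto_zero[OF acf'] f'0 x_0 by (cases "n = 0") (auto simp: P_def)
  have y_left: "(f \<longlongrightarrow> y (n + 1)) (at_left (x (n + 1)))" for n
    using v(2)[of "n + 1"] by (simp add: y_def)
  have q_left: "(D1 f \<longlongrightarrow> q (n + 1)) (at_left (x (n + 1)))" for n
    using q[of "n + 1"] by simp
  have y0: "y n = 0" if "n \<ge> N" for n
  proof -
    have zero: "f t = 0" if t: "t \<in> {x n<..<x (n + 1)}" for t
    proof (rule N(2))
      show "t \<in> I - X" using interval_subset t by blast
      have "x N \<le> x n" using \<open>n \<ge> N\<close> strict_mono_x by (simp add: strict_mono_less_eq)
      then show "x N < t" using t by simp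
    qed
    have "\<forall>\<^sub>F t in at_right (x n). 0 = f t"
      by (rule eventually_at_rightI[OF _ x_Suc]) (use zero in auto)
    then have "(f \<longlongrightarrow> 0) (at_right (x n))"
      by (rule Lim_transform_eventually[OF tendsto_const])
    then show ?thesis
      using tendsto_unique[OF _ y_right] by (metis trivial_limit_at_right_real)
  qed
  \<comment> \<open>One negligible set \<open>Z\<close> covers all points of \<open>I\<close> at
    which f'' may fail to exist, and serves every node interval.\<close>
  have "AE t in lebesgue. t \<in> I \<longrightarrow> D1 f differentiable (at t within I - X)"
    using df' I_lebesgue by (simp add: AE_restrict_space_iff)
  then obtain Z where "Z \<in> null_sets lebesgue"
    and Z: "{t \<in> space lebesgue. \<not> (t \<in> I \<longrightarrow> D1 f differentiable (at t within I - X))} \<subseteq> Z"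
    unfolding eventually_ae_filter by blast
  then have negZ: "negligible Z" by (simp add: negligible_iff_null_sets)
  have acI: "AC_on s t g" if "AC_loc (I - X) g" "x n < s" "s \<le> t" "t < x (n + 1)" for s t n g
  proof -
    have "{s..t} \<subseteq> {x n<..<x (n + 1)}" using that by auto
    then show ?thesis using that interval_subset[of n] by (meson AC_loc_def order_trans)
  qed
  have der1: "(f has_vector_derivative D1 f t) (at t)" if "x n < t" "t < x (n + 1)" for n t
  proof -
    have "t \<in> I - X" using interval_subset[of n] that by auto
    then have "f differentiable (at t within I - X)" using df by (simp add: differentiable_on_def)
    then show ?thesis
      unfolding deriv_within_def at_within_interval[OF that] by (simp add: vector_derivative_works)
  qed
  have der2: "(D1 f has_vector_derivative D1 (D1 f) t) (at t)" if "x n < t" "t < x (n + 1)" "t \<notin> Z" for n t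
  proof -
    have "t \<in> I - X" using interval_subset[of n] that by auto
    then have "D1 f differentiable (at t within I - X)" using Z \<open>t \<notin> Z\<close> by auto
    then show ?thesis
      unfolding deriv_within_def[of "I - X" "D1 f"] at_within_interval[OF that(1,2)]
      by (simp add: vector_derivative_works)
  qed
  have int: "integrable (lebesgue_on I) (\<lambda>t. D1 (D1 f) t * cnj (f t))"
    by (rule integrable_L2_mult[OF f''_L2 f_L2])
  note split = integral_split[OF int, of N]
  let ?E = "\<lambda>n. integral {x n..x (n + 1)} (\<lambda>t. (cmod (D1 f t))\<^sup>2)"
  note form = interval_form[OF x_Suc acI[OF acf] acI[OF acf'] der1 negZ der2 _ y_right y_left P_right q_left]
  have "L2_inner (lebesgue_on I) (\<lambda>t. - D1 (D1 f) t) f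
      = - (\<Sum>n<N. integral {x n..x (n + 1)} (\<lambda>t. D1 (D1 f) t * cnj (f t)))"
    unfolding L2_inner_def using split(1) N(2) by simp
  also have "\<dots> = - (\<Sum>n<N. q (n + 1) * cnj (y (n + 1)) - P n * cnj (y n) - of_real (?E n))"
    using split(2) N(2) by (intro arg_cong[where f = uminus] sum.cong refl form(1)) auto
  also have "\<dots> = (\<Sum>n<N. of_real (?E n) + (P n * cnj (y n) - q (n + 1) * cnj (y (n + 1))))"
    unfolding sum_negf[symmetric] by (intro sum.cong) auto
  also have "\<dots> = of_real (\<Sum>n<N. ?E n) + (\<Sum>n<N. P n * cnj (y n) - q (n + 1) * cnj (y (n + 1)))"
    by (simp add: sum.distrib)
  \<comment> \<open>The two unmatched terms vanish, by \<open>P 0 = 0\<close> at the left end and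
    \<open>y N = 0\<close> at the right end.\<close>
  also have "(\<Sum>n<N. P n * cnj (y n) - q (n + 1) * cnj (y (n + 1))) = (\<Sum>n=1..<N. P n * cnj (y n) - q n * cnj (y n))"
    by (rule sum_shift_diff[OF N(1), of "\<lambda>n. P n * cnj (y n)" "\<lambda>n. q n * cnj (y n)"]) (use y0 in \<open>auto simp: P_def\<close>)
  also have "\<dots> = (\<Sum>n=1..<N. of_real (\<alpha> n * (cmod (y n))\<^sup>2))"
  proof (rule sum.cong[OF refl])
    fix n assume "n \<in> {1..<N}"
    then have n: "n \<ge> 1" by simp
    then have "P n * cnj (y n) - q n * cnj (y n) = (p n - q n) * cnj (y n)"
      by (simp add: P_def left_diff_distrib)
    also have "\<dots> = of_real (\<alpha> n) * (y n * cnj (y n))"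
      unfolding jump[OF n] using n by (simp add: y_def)
    also have "\<dots> = of_real (\<alpha> n * (cmod (y n))\<^sup>2)"
      by (simp only: complex_norm_square of_real_mult)
    finally show "P n * cnj (y n) - q n * cnj (y n) = of_real (\<alpha> n * (cmod (y n))\<^sup>2)" .
  qed
  finally have inner: "L2_inner (lebesgue_on I) (\<lambda>t. - D1 (D1 f) t) f =
      of_real ((\<Sum>n<N. ?E n) + (\<Sum>n=1..<N. \<alpha> n * (cmod (y n))\<^sup>2))"
    by simp
  have norm: "(L2_norm (lebesgue_on I) f)\<^sup>2 = (\<Sum>n<N. integral {x n..x (n + 1)} (\<lambda>t. (cmod (f t))\<^sup>2))"
    unfolding L2_norm_power2 by (rule integral_split(1)[OF L2_spaceD(2)[OF f_L2]]) (use N(2) in simp)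
  show thesis
    by (rule that[OF y0 y_right inner norm form(2)]) (use split(2) N(2) in auto)
qed

lemma H_dom_support:
  assumes "f \<in> H_dom b x \<alpha>"
  shows "\<exists>N\<ge>1. \<forall>t\<in>I - X. x N < t \<longrightarrow> f t = 0"
proof -
  have "f \<in> W22_comp I X" using assms unfolding H_dom_def Let_def by auto
  then obtain N where "N \<ge> 1" "\<And>t. t \<in> I - X \<Longrightarrow> x N < t \<Longrightarrow> f t = 0"
    using W22_comp_support by metis
  then show ?thesis by blast
qed

text \<open>The reality clause is automatic, since Green's formula exhibits (H f, f) as a real
  number.\<close>

lemma H_op_semibounded_iff:
  "lower_semibounded (lebesgue_on I) (H_op b x \<alpha>) \<longleftrightarrow> (\<exists>c. \<forall>f\<in>H_dom b x \<alpha>.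
     c * (L2_norm (lebesgue_on I) f)\<^sup>2 \<le> Re (L2_inner (lebesgue_on I) (\<lambda>t. - D1 (D1 f) t) f))"
proof -
  let ?M = "lebesgue_on I"
  let ?T = "{(f, \<lambda>t. - D1 (D1 f) t) | f. f \<in> H_dom b x \<alpha>}"
  have "?T \<subseteq> L2_space ?M \<times> L2_space ?M"
  proof clarify
    fix f assume "f \<in> H_dom b x \<alpha>"
    then have "f \<in> L2_space ?M" "D1 (D1 f) \<in> L2_space ?M"
      by (auto simp: H_dom_def W22_comp_def W22_def Let_def)
    then show "f \<in> L2_space ?M \<and> (\<lambda>t. - D1 (D1 f) t) \<in> L2_space ?M"
      by (simp add: L2_space_def)
  qed
  then have "lower_semibounded ?M (H_op b x \<alpha>) \<longleftrightarrow> lower_semibounded ?M ?T"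
    unfolding H_op_def Let_def by (rule lower_semibounded_op_closure_iff)
  also have "\<dots> \<longleftrightarrow> (\<exists>c. \<forall>f\<in>H_dom b x \<alpha>. L2_inner ?M (\<lambda>t. - D1 (D1 f) t) f \<in> \<real> \<and>
     c * (L2_norm ?M f)\<^sup>2 \<le> Re (L2_inner ?M (\<lambda>t. - D1 (D1 f) t) f))"
    unfolding lower_semibounded_def by (intro ex_cong1) auto
  also have "\<dots> \<longleftrightarrow> (\<exists>c. \<forall>f\<in>H_dom b x \<alpha>. c * (L2_norm ?M f)\<^sup>2 \<le> Re (L2_inner ?M (\<lambda>t. - D1 (D1 f) t) f))"
  proof -
    have "L2_inner ?M (\<lambda>t. - D1 (D1 f) t) f \<in> \<real>" if f: "f \<in> H_dom b x \<alpha>" for f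
    proof -
      obtain N where N: "N \<ge> 1" "\<forall>t\<in>I - X. x N < t \<longrightarrow> f t = 0"
        using H_dom_support[OF f] by blast
      show ?thesis
        by (rule H_dom_form[OF f N]) (simp_all only: Reals_of_real)
    qed
    then show ?thesis by simp
  qed
  finally show ?thesis .
qed

text \<open>The energy bound, used with one \<kappa> for all intervals, yields the edge terms
  together with enough mass to compensate the lower bound of the graph form. Boundedness of
  \<open>d\<close> makes its cost \<open>K\<close> uniform in n.\<close>

lemma graph_form_bounded_imp_H_semibounded:
  assumes d: "\<And>n. n \<ge> 1 \<Longrightarrow> d n = x n - x (n - 1)" and "bdd_above (d ` {1..})"
    and "graph_form_bounded d \<alpha>"
  shows "lower_semibounded (lebesgue_on I) (H_op b x \<alpha>)"
proof -
  obtain c where c: "\<And>y N. y 0 = 0 \<Longrightarrow> (\<forall>n\<ge>N. y n = 0) \<Longrightarrow> c * graph_mass d N y \<le> graph_form d \<alpha> N y"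
    using assms(3) unfolding graph_form_bounded_def by blast
  obtain D where D: "\<And>n. n \<ge> 1 \<Longrightarrow> d n \<le> D"
    using assms(2) unfolding bdd_above_def by auto
  have d_Suc: "d (n + 1) = x (n + 1) - x n" for n using d[of "n + 1"] by simp
  have d_pos: "d (n + 1) > 0" for n using x_Suc[of n] d_Suc[of n] by linarith
  define C where "C = \<bar>c\<bar>"
  \<comment> \<open>Half of \<kappa> is \<open>C\<close>, which pays for the lower bound
    \<open>c\<close>, plus 1 / d_1^2, which pays for |y_1|^2 / d_1 on the first interval.\<close>
  define \<kappa> where "\<kappa> = 2 * (C + 1 / (d 1)\<^sup>2)"
  define K where "K = 6 * \<kappa> + \<kappa>\<^sup>2 * D\<^sup>2"
  have "\<kappa> \<ge> 0" "C \<ge> 0" by (auto simp: \<kappa>_def C_def)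
  have "- K * (L2_norm (lebesgue_on I) f)\<^sup>2 \<le> Re (L2_inner (lebesgue_on I) (\<lambda>t. - D1 (D1 f) t) f)"
    if f: "f \<in> H_dom b x \<alpha>" for f
  proof -
    let ?E = "\<lambda>n. integral {x n..x (n + 1)} (\<lambda>t. (cmod (D1 f t))\<^sup>2)"
    let ?F = "\<lambda>n. integral {x n..x (n + 1)} (\<lambda>t. (cmod (f t))\<^sup>2)"
    obtain N where N: "N \<ge> 1" "\<forall>t\<in>I - X. x N < t \<longrightarrow> f t = 0"
      using H_dom_support[OF f] by blast
    obtain y where y: "\<And>n. n \<ge> N \<Longrightarrow> y n = 0"
      and "\<And>n. n \<ge> 1 \<Longrightarrow> (f \<longlongrightarrow> y n) (at_right (x n))"
      and inner: "L2_inner (lebesgue_on I) (\<lambda>t. - D1 (D1 f) t) f = of_real ((\<Sum>n<N. ?E n) + (\<Sum>n=1..<N. \<alpha> n * (cmod (y n))\<^sup>2))"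
      and norm: "(L2_norm (lebesgue_on I) f)\<^sup>2 = (\<Sum>n<N. ?F n)"
      and bound: "\<And>n \<kappa>. \<kappa> \<ge> 0 \<Longrightarrow> (cmod (y (n + 1) - y n))\<^sup>2 / (x (n + 1) - x n)
      + \<kappa> / 2 * ((x (n + 1) - x n) * ((cmod (y n))\<^sup>2 + (cmod (y (n + 1)))\<^sup>2))
      \<le> ?E n + (6 * \<kappa> + \<kappa>\<^sup>2 * (x (n + 1) - x n)\<^sup>2) * ?F n"
      using that by (rule H_dom_form[OF f N])
    \<comment> \<open>The Jacobi side demands value 0 at index 0, while f(0) is arbitrary; only the
      edge from 0 to 1 is affected.\<close>
    define z where "z n = (if n = 0 then 0 else y n)" for n
    \<comment> \<open>A nonintegrable function has integral 0 by convention, so both cases are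
      harmless.\<close>
    have F_nonneg: "0 \<le> ?F n" for n
      using not_integrable_integral[of "\<lambda>t. (cmod (f t))\<^sup>2"]
      by (cases "(\<lambda>t. (cmod (f t))\<^sup>2) integrable_on {x n..x (n + 1)}")
        (auto intro: Henstock_Kurzweil_Integration.integral_nonneg)
    have step: "(cmod (z (n + 1) - z n))\<^sup>2 / d (n + 1) + C * (d (n + 1) * ((cmod (z n))\<^sup>2 + (cmod (z (n + 1)))\<^sup>2))
       \<le> ?E n + K * ?F n" for n
    proof -
      have "(6 * \<kappa> + \<kappa>\<^sup>2 * (d (n + 1))\<^sup>2) * ?F n \<le> K * ?F n"
        using D[of "n + 1"] d_pos[of n] \<open>\<kappa> \<ge> 0\<close> unfolding K_def
        by (intro mult_right_mono add_mono mult_left_mono power_mono F_nonneg) auto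
      with bound[OF \<open>\<kappa> \<ge> 0\<close>, of n, folded d_Suc] have *: "(cmod (y (n + 1) - y n))\<^sup>2 / d (n + 1)
        + \<kappa> / 2 * (d (n + 1) * ((cmod (y n))\<^sup>2 + (cmod (y (n + 1)))\<^sup>2)) \<le> ?E n + K * ?F n" by linarith
      show ?thesis
      proof (cases "n = 0")
        case True
        have "(cmod (y 1))\<^sup>2 / d 1 + C * (d 1 * (cmod (y 1))\<^sup>2) = \<kappa> / 2 * (d 1 * (cmod (y 1))\<^sup>2)"
          using d_pos[of 0] by (simp add: \<kappa>_def power2_eq_square field_simps)
        also have "\<dots> \<le> (cmod (y 1 - y 0))\<^sup>2 / d 1 + \<kappa> / 2 * (d 1 * ((cmod (y 0))\<^sup>2 + (cmod (y 1))\<^sup>2))"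
        proof -
          have "0 \<le> (cmod (y 1 - y 0))\<^sup>2 / d 1" "0 \<le> \<kappa> / 2 * (d 1 * (cmod (y 0))\<^sup>2)"
            using d_pos[of 0] \<open>\<kappa> \<ge> 0\<close> by simp_all
          then show ?thesis unfolding distrib_left by linarith
        qed
        finally show ?thesis using * True by (simp add: z_def)
      next
        case False
        have "C * (d (n + 1) * ((cmod (y n))\<^sup>2 + (cmod (y (n + 1)))\<^sup>2))
            \<le> \<kappa> / 2 * (d (n + 1) * ((cmod (y n))\<^sup>2 + (cmod (y (n + 1)))\<^sup>2))"
          using d_pos[of n] by (intro mult_right_mono) (auto simp: \<kappa>_def)
        then show ?thesis using * False by (simp add: z_def)
      qed
    qed
    have mass_eq: "(\<Sum>n<N. C * (d (n + 1) * ((cmod (z n))\<^sup>2 + (cmod (z (n + 1)))\<^sup>2))) = C * graph_mass d N z"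
      by (simp only: graph_mass_def sum_distrib_left)
    \<comment> \<open>The sign of \<open>c\<close> is unknown; with \<open>- C\<close>, the mass to
      be added is nonnegative.\<close>
    have "- C * graph_mass d N z \<le> c * graph_mass d N z"
    proof (rule mult_right_mono)
      show "0 \<le> graph_mass d N z"
        using d_pos unfolding graph_mass_def by (intro sum_nonneg mult_nonneg_nonneg add_nonneg_nonneg) (auto intro: less_imp_le)
    qed (simp add: C_def)
    also have "\<dots> \<le> graph_form d \<alpha> N z"
      by (rule c) (use y in \<open>auto simp: z_def\<close>)
    also have "\<dots> = (\<Sum>n<N. (cmod (z (n + 1) - z n))\<^sup>2 / d (n + 1)) + (\<Sum>n=1..<N. \<alpha> n * (cmod (y n))\<^sup>2)"
      unfolding graph_form_def by (simp add: z_def)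
    finally have "0 \<le> (\<Sum>n<N. (cmod (z (n + 1) - z n))\<^sup>2 / d (n + 1) + C * (d (n + 1) * ((cmod (z n))\<^sup>2 + (cmod (z (n + 1)))\<^sup>2)))
        + (\<Sum>n=1..<N. \<alpha> n * (cmod (y n))\<^sup>2)"
      unfolding sum.distrib mass_eq by linarith
    also have "\<dots> \<le> (\<Sum>n<N. ?E n + K * ?F n) + (\<Sum>n=1..<N. \<alpha> n * (cmod (y n))\<^sup>2)"
      by (intro add_right_mono sum_mono step)
    finally show ?thesis
      unfolding inner norm Re_complex_of_real sum.distrib sum_distrib_left[symmetric] by linarith
  qed
  then show ?thesis unfolding H_op_semibounded_iff by blast
qed

end

section \<open>Piecewise polynomial functions\<close>

text \<open>Polynomials are Lipschitz on a complex disc containing the interval, by the mean value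
  inequality on that convex set.\<close>

lemma AC_on_poly:
  fixes Q :: "complex poly"
  shows "AC_on a c (\<lambda>t. poly Q (of_real t))"
proof -
  define R where "R = max \<bar>a\<bar> \<bar>c\<bar>"
  have "bounded (poly (pderiv Q) ` cball 0 R)"
    by (intro compact_imp_bounded compact_continuous_image continuous_intros compact_cball)
  then obtain B where B: "B > 0" "\<And>z. z \<in> cball 0 R \<Longrightarrow> cmod (poly (pderiv Q) z) \<le> B"
    unfolding bounded_pos by blast
  have lip: "cmod (poly Q (of_real v) - poly Q (of_real u)) \<le> B * (v - u)" if "a \<le> u" "u \<le> v" "v \<le> c" for u v
  proof -
    have "cmod (poly Q (of_real v) - poly Q (of_real u)) \<le> B * cmod (of_real v - of_real u)"
    proof (rule field_differentiable_bound[OF convex_cball])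
      show "(poly Q has_field_derivative poly (pderiv Q) z) (at z within cball 0 R)" for z
        by (rule has_field_derivative_at_within[OF poly_DERIV])
    qed (use B that in \<open>auto simp: R_def\<close>)
    then show ?thesis using that by (simp add: norm_of_real flip: of_real_diff)
  qed
  show ?thesis
    unfolding AC_on_iff
  proof (intro allI impI)
    fix e :: real assume "e > 0"
    have "(\<Sum>(u, v)\<in>P. cmod (poly Q (of_real v) - poly Q (of_real u))) < e"
      if P: "interval_family a c P" and len: "(\<Sum>(u, v)\<in>P. v - u) < e / B" for P
    proof -
      have "(\<Sum>(u, v)\<in>P. cmod (poly Q (of_real v) - poly Q (of_real u))) \<le> (\<Sum>(u, v)\<in>P. B * (v - u))"
        by (rule sum_mono) (use P lip in \<open>auto simp: interval_family_def\<close>)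
      also have "\<dots> = B * (\<Sum>(u, v)\<in>P. v - u)"
        by (simp add: sum_distrib_left case_prod_unfold)
      also have "\<dots> < B * (e / B)"
        using len B(1) by (rule mult_strict_left_mono)
      also have "\<dots> = e" using B(1) by simp
      finally show ?thesis .
    qed
    moreover have "e / B > 0" using \<open>e > 0\<close> B(1) by simp
    ultimately show "\<exists>\<delta>>0. \<forall>P. interval_family a c P \<longrightarrow> (\<Sum>(u, v)\<in>P. v - u) < \<delta> \<longrightarrow>
        (\<Sum>(u, v)\<in>P. cmod (poly Q (of_real v) - poly Q (of_real u))) < e"
      by blast
  qed
qed

lemma has_vector_derivative_poly_of_real:
  fixes Q :: "complex poly"
  shows "((\<lambda>t. poly Q (of_real t)) has_vector_derivative poly (pderiv Q) (of_real t)) (at t within S)"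
  using has_vector_derivative_at_within[OF has_vector_derivative_real_field[OF poly_DERIV]] .

section \<open>Piecewise polynomials as elements of the domain\<close>

context node_sequence
begin

definition node_index :: "real \<Rightarrow> nat" where
  "node_index t = (THE n. x n \<le> t \<and> t < x (n + 1))"

lemma node_index_eq: "x n \<le> t \<Longrightarrow> t < x (n + 1) \<Longrightarrow> node_index t = n"
  unfolding node_index_def by (rule the_equality) (use interval_unique in blast)+

text \<open>At a node the polynomial of the interval on its right is taken; this choice is
  immaterial, except at 0, which is not in \<open>X\<close>.\<close>

definition piecewise :: "(nat \<Rightarrow> complex poly) \<Rightarrow> real \<Rightarrow> complex" where
  "piecewise Q t = poly (Q (node_index t)) (of_real t)"

lemma piecewise_eq: "x n \<le> t \<Longrightarrow> t < x (n + 1) \<Longrightarrow> piecewise Q t = poly (Q n) (of_real t)"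
  by (simp add: piecewise_def node_index_eq)

lemma regular_cases:
  assumes "t \<in> I - X"
  obtains n where "x n < t" "t < x (n + 1)" | "t = 0"
proof -
  have "t \<in> I" using assms by simp
  then obtain n where n: "x n \<le> t" "t < x (n + 1)" by (rule interval_cover)
  show ?thesis
  proof (cases "t = x n")
    case True
    then have "n = 0" using assms by (metis DiffD2 atLeast_iff image_eqI not_one_le_zero less_one not_le)
    then show ?thesis using that(2) True x_0 by simp
  next
    case False
    then show ?thesis using that(1)[of n] n by simp
  qed
qed

lemma at_regular_nontrivial:
  assumes "t \<in> I - X"
  shows "at t within (I - X) \<noteq> bot"
  using assms
proof (rule regular_cases)
  fix n assume "x n < t" "t < x (n + 1)"
  then show ?thesis unfolding at_within_interval[OF \<open>x n < t\<close> \<open>t < x (n + 1)\<close>] by simp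
next
  assume "t = 0"
  then show ?thesis unfolding \<open>t = 0\<close> at_within_zero by (rule_tac trivial_limit_at_right_real)
qed

text \<open>Stated for any \<open>g\<close> that agrees with the piecewise polynomial on
  \<open>I - X\<close>, because the first derivative is known only there and the lemma is applied to
  it again.\<close>

lemma piecewise_has_derivative:
  assumes g: "\<And>t. t \<in> I - X \<Longrightarrow> g t = piecewise Q t" and t: "t \<in> I - X"
  shows "(g has_vector_derivative piecewise (\<lambda>n. pderiv (Q n)) t) (at t within (I - X))"
proof -
  have *: "(g has_vector_derivative poly (pderiv (Q n)) t) (at t within (I - X))"
    if "e > 0" and near: "\<And>s. s \<in> I - X \<Longrightarrow> dist s t < e \<Longrightarrow> x n \<le> s \<and> s < x (n + 1)" for n e
  proof (rule has_vector_derivative_transform_within[OF has_vector_derivative_poly_of_real \<open>e > 0\<close> t])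
    fix s assume s: "s \<in> I - X" "dist s t < e"
    then have "x n \<le> s" "s < x (n + 1)" using near by blast+
    then show "poly (Q n) (of_real s) = g s"
      using g[OF s(1)] by (simp add: piecewise_eq)
  qed
  show ?thesis
    using t
  proof (rule regular_cases)
    fix n assume n: "x n < t" "t < x (n + 1)"
    have "(g has_vector_derivative poly (pderiv (Q n)) t) (at t within (I - X))"
    proof (rule *)
      show "min (t - x n) (x (n + 1) - t) > 0" using n by simp
      show "x n \<le> s \<and> s < x (n + 1)" if "dist s t < min (t - x n) (x (n + 1) - t)" for s
        using that unfolding dist_real_def by linarith
    qed
    then show ?thesis using n by (simp only: piecewise_eq[OF less_imp_le])
  next
    assume "t = 0"
    have "(g has_vector_derivative poly (pderiv (Q 0)) t) (at t within (I - X))"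
    proof (rule *)
      show "x 1 > 0" using x_Suc[of 0] x_0 by simp
      show "x 0 \<le> s \<and> s < x (0 + 1)" if "s \<in> I - X" "dist s t < x 1" for s
      proof -
        have "0 \<le> s" using that(1) by (simp add: half_open_def)
        then show ?thesis using that(2) x_0 \<open>t = 0\<close> by (simp add: dist_real_def)
      qed
    qed
    then show ?thesis using \<open>t = 0\<close> x_0 x_Suc[of 0] by (simp only: piecewise_eq[of 0] order_refl)
  qed
qed

lemma piecewise_deriv:
  assumes "\<And>t. t \<in> I - X \<Longrightarrow> g t = piecewise Q t" and "t \<in> I - X"
  shows "D1 g t = piecewise (\<lambda>n. pderiv (Q n)) t"
  unfolding deriv_within_def
  by (rule vector_derivative_within[OF at_regular_nontrivial[OF assms(2)] piecewise_has_derivative[OF assms]])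

text \<open>A compact interval inside \<open>I - X\<close> contains no node, hence lies in a single
  node interval, where \<open>g\<close> is one polynomial.\<close>

lemma piecewise_AC_loc:
  assumes "\<And>t. t \<in> I - X \<Longrightarrow> g t = piecewise Q t"
  shows "AC_loc (I - X) g"
  unfolding AC_loc_def
proof (intro allI impI)
  fix a c :: real assume "a \<le> c" and sub: "{a..c} \<subseteq> I - X"
  have "a \<in> I" using subsetD[OF sub, of a] \<open>a \<le> c\<close> by simp
  then obtain n where n: "x n \<le> a" "a < x (n + 1)" by (rule interval_cover)
  have "c < x (n + 1)"
  proof (rule ccontr)
    assume "\<not> c < x (n + 1)"
    then have "x (n + 1) \<in> I - X" using subsetD[OF sub, of "x (n + 1)"] n by simp
    then show False by simp
  qed
  show "AC_on a c g"
  proof (rule AC_on_cong[OF _ AC_on_poly[of a c "Q n"]])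
    fix t assume t: "t \<in> {a..c}"
    then have "t \<in> I - X" "x n \<le> t" "t < x (n + 1)"
      using subsetD[OF sub, of t] n \<open>c < x (n + 1)\<close> by simp_all
    then show "poly (Q n) (of_real t) = g t" using assms by (simp add: piecewise_eq)
  qed
qed

lemma integrable_piecewise_continuous:
  fixes \<phi> :: "real \<Rightarrow> 'a::euclidean_space"
  assumes \<psi>: "\<And>n. continuous_on UNIV (\<psi> n)" "\<And>n t. x n < t \<Longrightarrow> t < x (n + 1) \<Longrightarrow> \<phi> t = \<psi> n t"
    and zero: "\<And>t. t \<in> I - X \<Longrightarrow> x N < t \<Longrightarrow> \<phi> t = 0"
  shows "integrable (lebesgue_on I) \<phi>"
proof -
  have "\<phi> absolutely_integrable_on {x n..x (n + 1)}" for n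
  proof (rule absolutely_integrable_spike)
    show "\<psi> n absolutely_integrable_on {x n..x (n + 1)}"
      by (intro absolutely_integrable_continuous_real continuous_on_subset[OF \<psi>(1)]) simp
    show "negligible {x n, x (n + 1)}" by simp
  qed (use \<psi>(2) in auto)
  then have "\<phi> absolutely_integrable_on {x 0..x n}" for n
  proof (induction n)
    case 0
    show ?case by (rule absolutely_integrable_on_subinterval[OF 0[of 0]]) (use x_Suc[of 0] in simp)
  next
    case (Suc n)
    have "{x 0..x (Suc n)} = {x 0..x n} \<union> {x n..x (n + 1)}"
      using x_nonneg[of n] x_Suc[of n] x_0 by auto
    then show ?case using absolutely_integrable_Un[OF Suc.IH[OF Suc.prems] Suc.prems[of n]] by simp
  qed
  then have "\<phi> absolutely_integrable_on {0..x N}" using x_0 by metis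
  then have "(\<lambda>t. if t \<in> {0..x N} then \<phi> t else 0) absolutely_integrable_on UNIV"
    by (simp only: absolutely_integrable_restrict_UNIV)
  then have "(\<lambda>t. if t \<in> I then \<phi> t else 0) absolutely_integrable_on UNIV"
  proof (rule absolutely_integrable_spike[OF _ negligible_X])
    fix t assume t: "t \<in> UNIV - X"
    show "(if t \<in> I then \<phi> t else 0) = (if t \<in> {0..x N} then \<phi> t else 0)"
    proof (cases "t \<in> I")
      case True
      then have "0 \<le> t" by (simp add: half_open_def)
      then show ?thesis using True t zero[of t] by (cases "t \<le> x N") auto
    next
      case False
      then have "t \<notin> {0..x N}" using subsetD[OF Icc_subset_I] by blast
      then show ?thesis using False by (simp only: if_False)
    qed
  qed
  then have "\<phi> absolutely_integrable_on I"
    by (simp only: absolutely_integrable_restrict_UNIV)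
  then show ?thesis
    using I_lebesgue by (simp add: set_integrable_def integrable_restrict_space)
qed

lemma piecewise_L2:
  assumes g: "\<And>t. t \<in> I - X \<Longrightarrow> g t = piecewise Q t" and Q: "\<And>n. n \<ge> N \<Longrightarrow> Q n = 0"
  shows "g \<in> L2_space (lebesgue_on I)"
proof -
  have eq: "g t = poly (Q n) (of_real t)" if "x n < t" "t < x (n + 1)" for n t
  proof -
    have "t \<in> I - X" by (rule subsetD[OF interval_subset[of n]]) (use that in simp)
    then show ?thesis using g that by (simp add: piecewise_eq)
  qed
  have zero: "g t = 0" if "t \<in> I - X" "x N < t" for t
    using that(1)
  proof (rule regular_cases)
    fix n assume n: "x n < t" "t < x (n + 1)"
    then have "x N < x (n + 1)" using that by simp
    then have "n \<ge> N" using strict_mono_less[OF strict_mono_x] by simp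
    then show ?thesis using eq[OF n] Q by simp
  next
    assume "t = 0"
    then show ?thesis using that(2) x_nonneg[of N] by simp
  qed
  have "integrable (lebesgue_on I) g"
    by (rule integrable_piecewise_continuous[where \<psi> = "\<lambda>n t. poly (Q n) (of_real t)" and N = N])
      (auto intro!: continuous_intros simp: eq zero)
  moreover have "integrable (lebesgue_on I) (\<lambda>t. (cmod (g t))\<^sup>2)"
    by (rule integrable_piecewise_continuous[where \<psi> = "\<lambda>n t. (cmod (poly (Q n) (of_real t)))\<^sup>2" and N = N])
      (auto intro!: continuous_intros simp: eq zero)
  ultimately show ?thesis by (auto simp: L2_space_def)
qed

lemma piecewise_limits:
  assumes g: "\<And>t. t \<in> I - X \<Longrightarrow> g t = piecewise Q t"
  shows "(g \<longlongrightarrow> poly (Q n) (of_real (x n))) (at_right (x n))"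
    and "(g \<longlongrightarrow> poly (Q n) (of_real (x (n + 1)))) (at_left (x (n + 1)))"
proof -
  have eq: "poly (Q n) (of_real t) = g t" if "t \<in> {x n<..<x (n + 1)}" for t
    using g[OF subsetD[OF interval_subset that]] that piecewise_eq[of n t Q] by simp
  have lim: "((\<lambda>t. poly (Q n) (of_real t)) \<longlongrightarrow> poly (Q n) (of_real s)) (at s within S)" for s :: real and S
    by (intro tendsto_intros)
  show "(g \<longlongrightarrow> poly (Q n) (of_real (x n))) (at_right (x n))"
    by (rule Lim_transform_eventually[OF lim], rule eventually_at_rightI[OF _ x_Suc[of n]]) (rule eq)
  show "(g \<longlongrightarrow> poly (Q n) (of_real (x (n + 1)))) (at_left (x (n + 1)))"
    by (rule Lim_transform_eventually[OF lim], rule eventually_at_leftI[OF _ x_Suc[of n]]) (rule eq)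
qed

text \<open>Regularity and square integrability hold for every piecewise polynomial with finitely
  many nonzero pieces, so only algebraic matching conditions at the nodes and at 0 remain.\<close>

lemma piecewise_in_H_dom:
  assumes Q: "\<And>n. n \<ge> N \<Longrightarrow> Q n = 0"
    and cont: "\<And>n. poly (Q n) (of_real (x (n + 1))) = poly (Q (n + 1)) (of_real (x (n + 1)))"
    and jump: "\<And>n. poly (pderiv (Q (n + 1))) (of_real (x (n + 1))) - poly (pderiv (Q n)) (of_real (x (n + 1))) =
      of_real (\<alpha> (n + 1)) * poly (Q (n + 1)) (of_real (x (n + 1)))"
    and zero: "poly (pderiv (Q 0)) 0 = 0"
  shows "piecewise Q \<in> H_dom b x \<alpha>"
proof -
  let ?f = "piecewise Q"
  have f': "D1 ?f t = piecewise (\<lambda>n. pderiv (Q n)) t" if "t \<in> I - X" for t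
    using piecewise_deriv[OF refl that] .
  have f'': "D1 (D1 ?f) t = piecewise (\<lambda>n. pderiv (pderiv (Q n))) t" if "t \<in> I - X" for t
    using piecewise_deriv[OF f' that] .
  have diff: "g differentiable (at t within I - X)" if "\<And>t. t \<in> I - X \<Longrightarrow> g t = piecewise R t" "t \<in> I - X" for g R t
    using piecewise_has_derivative[OF that] by (rule differentiableI_vector)
  have AE_X: "AE t in lebesgue_on I. t \<in> I - X"
  proof -
    have "AE t in lebesgue. t \<notin> X"
      using negligible_X by (simp add: negligible_iff_null_sets AE_not_in)
    then have "AE t in lebesgue. t \<in> I \<longrightarrow> t \<in> I - X" by (rule eventually_mono) simp
    then show ?thesis using I_lebesgue by (simp add: AE_restrict_space_iff)
  qed
  have "?f \<in> W22 I X"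
    unfolding W22_def Let_def mem_Collect_eq
  proof (intro conjI)
    show "?f \<in> L2_space (lebesgue_on I)"
      by (rule piecewise_L2[OF refl Q])
    show "D1 (D1 ?f) \<in> L2_space (lebesgue_on I)"
      by (rule piecewise_L2[OF f'', of N]) (simp_all add: Q)
    show "AC_loc (I - X) ?f" "AC_loc (I - X) (D1 ?f)"
      by (rule piecewise_AC_loc[OF refl], rule piecewise_AC_loc[OF f'])
    show "?f differentiable_on (I - X)"
      unfolding differentiable_on_def using diff[OF refl] by blast
    show "AE t in lebesgue_on I. D1 ?f differentiable (at t within I - X)"
      using AE_X by (rule eventually_mono) (rule diff[OF f'])
  qed
  moreover have "compact (I \<inter> closure {t \<in> I - X. ?f t \<noteq> 0})"
  proof -
    have "t \<le> x N" if t: "t \<in> I" "?f t \<noteq> 0" for t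
    proof (rule ccontr)
      assume "\<not> t \<le> x N"
      obtain n where n: "x n \<le> t" "t < x (n + 1)" using t(1) by (rule interval_cover)
      then have "x N < x (n + 1)" using \<open>\<not> t \<le> x N\<close> by simp
      then have "n \<ge> N" using strict_mono_less[OF strict_mono_x] by simp
      then show False using t(2) Q by (simp add: piecewise_eq[OF n])
    qed
    then have "{t \<in> I - X. ?f t \<noteq> 0} \<subseteq> {0..x N}" by (auto simp: half_open_def)
    then have sub: "closure {t \<in> I - X. ?f t \<noteq> 0} \<subseteq> {0..x N}" by (rule closure_minimal) simp
    then have "I \<inter> closure {t \<in> I - X. ?f t \<noteq> 0} = closure {t \<in> I - X. ?f t \<noteq> 0}"
      by (intro Int_absorb1 order_trans[OF sub Icc_subset_I])
    moreover have "bounded (closure {t \<in> I - X. ?f t \<noteq> 0})"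
      by (rule bounded_subset[OF _ sub]) simp
    ultimately show ?thesis by (simp add: compact_eq_bounded_closed)
  qed
  ultimately have "?f \<in> W22_comp I X" by (simp add: W22_comp_def)
  moreover have "D1 ?f 0 = 0"
  proof -
    have "0 \<in> I - X" by (rule subsetD[OF first_interval_subset]) (use x_Suc[of 0] x_0 in simp)
    then show ?thesis
      using f'[of 0] piecewise_eq[of 0 0] x_Suc[of 0] x_0 zero by simp
  qed
  moreover have "\<exists>v p q.
           (?f \<longlongrightarrow> v) (at_right (x n)) \<and> (?f \<longlongrightarrow> v) (at_left (x n)) \<and>
           (D1 ?f \<longlongrightarrow> p) (at_right (x n)) \<and> (D1 ?f \<longlongrightarrow> q) (at_left (x n)) \<and>
           p - q = complex_of_real (\<alpha> n) * v" if "n \<ge> 1" for n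
  proof -
    obtain m where n: "n = m + 1" using \<open>n \<ge> 1\<close> by (metis add.commute le_Suc_ex One_nat_def)
    show ?thesis
      unfolding n
      using piecewise_limits[of ?f Q, OF refl] piecewise_limits[OF f'] jump[of m] cont[of m] by metis
  qed
  ultimately show ?thesis unfolding H_dom_def Let_def by blast
qed

end

section \<open>Smoothed affine interpolants on one interval\<close>

text \<open>
  In the variable \<open>\<sigma> = (t - u) / L\<close> this interpolates the values \<open>a\<close>, \<open>a + e\<close> and the
  derivatives \<open>p / L\<close>, \<open>0\<close> at the end points of \<open>[u, u + L]\<close>, and it tends to the affine
  function in \<open>H\<^sup>1\<close> as \<open>k \<rightarrow> \<infinity>\<close>.
\<close>

definition hermite_poly :: "real \<Rightarrow> real \<Rightarrow> complex \<Rightarrow> complex \<Rightarrow> complex \<Rightarrow> nat \<Rightarrow> complex poly" where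
  "hermite_poly u L a e p k = (let s = [:- of_real (u / L), of_real (1 / L):] in
     [:a:] + smult e s + smult (p - e) (s * (1 - s) ^ (k + 2)) + smult e ((1 - s) * s ^ (k + 2)))"

text \<open>Zero at both ends, with slope 1 at 0 and slope 0 at 1: it changes one end slope and
  nothing else there. The exponent is at least 2 so that the slope at 1 vanishes for every k.
  Reflection gives the corrector for the other end.\<close>

definition bump :: "nat \<Rightarrow> real \<Rightarrow> real" where
  "bump k \<sigma> = \<sigma> * (1 - \<sigma>) ^ (k + 2)"

definition bump_deriv :: "nat \<Rightarrow> real \<Rightarrow> real" where
  "bump_deriv k \<sigma> = (1 - \<sigma>) ^ (k + 2) - real (k + 2) * \<sigma> * (1 - \<sigma>) ^ (k + 1)"

lemma poly_hermite_poly: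
  assumes "L > 0"
  shows "poly (hermite_poly u L a e p k) (of_real t) =
     a + e * of_real ((t - u) / L) + (p - e) * of_real (bump k ((t - u) / L))
       + e * of_real (bump k (1 - (t - u) / L))"
proof -
  have "poly [:- of_real (u / L), of_real (1 / L):] (complex_of_real t) = of_real ((t - u) / L)"
    by (simp add: diff_divide_distrib)
  then show ?thesis
    unfolding hermite_poly_def Let_def bump_def poly_add poly_smult poly_mult poly_power poly_diff poly_1
    by (simp only: of_real_mult of_real_power of_real_diff of_real_1) (simp add: algebra_simps)
qed

lemma poly_pderiv_hermite_poly:
  assumes "L > 0"
  shows "poly (pderiv (hermite_poly u L a e p k)) (of_real t) =
     (e + (p - e) * of_real (bump_deriv k ((t - u) / L)) - e * of_real (bump_deriv k (1 - (t - u) / L))) / of_real L"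
proof -
  define s where "s = [:- complex_of_real (u / L), of_real (1 / L):]"
  define \<sigma> where "\<sigma> = (t - u) / L"
  have s: "poly s (of_real t) = of_real \<sigma>"
    by (simp add: s_def \<sigma>_def diff_divide_distrib)
  have ds: "pderiv s = [:of_real (1 / L):]" by (simp add: s_def pderiv_pCons)
  have k2: "k + 2 = Suc (k + 1)" by simp
  have "pderiv (hermite_poly u L a e p k) =
      smult e [:of_real (1 / L):]
      + smult (p - e) (s * (smult (of_nat (Suc (k + 1))) ((1 - s) ^ (k + 1)) * - [:of_real (1 / L):]) + (1 - s) ^ (k + 2) * [:of_real (1 / L):])
      + smult e ((1 - s) * (smult (of_nat (Suc (k + 1))) (s ^ (k + 1)) * [:of_real (1 / L):]) + s ^ (k + 2) * - [:of_real (1 / L):])"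
    unfolding hermite_poly_def Let_def s_def[symmetric] pderiv_add pderiv_smult pderiv_mult k2 pderiv_power_Suc
      pderiv_diff pderiv_1 ds by (simp add: pderiv_pCons)
  then have "poly (pderiv (hermite_poly u L a e p k)) (of_real t) =
      e * of_real (1 / L)
      + (p - e) * (of_real \<sigma> * (of_nat (Suc (k + 1)) * (1 - of_real \<sigma>) ^ (k + 1) * - of_real (1 / L)) + (1 - of_real \<sigma>) ^ (k + 2) * of_real (1 / L))
      + e * ((1 - of_real \<sigma>) * (of_nat (Suc (k + 1)) * of_real \<sigma> ^ (k + 1) * of_real (1 / L)) + of_real \<sigma> ^ (k + 2) * - of_real (1 / L))"
    by (simp only: poly_add poly_smult poly_mult poly_power poly_diff poly_1 poly_minus poly_pCons poly_0 s
        mult_zero_right add_0_right)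
  also have "\<dots> = (e + (p - e) * of_real (bump_deriv k \<sigma>) - e * of_real (bump_deriv k (1 - \<sigma>))) / of_real L"
    using assms by (simp add: bump_deriv_def field_simps)
  finally show ?thesis unfolding \<sigma>_def .
qed

lemma bump_bound:
  assumes "0 \<le> \<sigma>" "\<sigma> \<le> 1"
  shows "\<bar>bump k \<sigma>\<bar> \<le> 1"
proof -
  have "\<sigma> * (1 - \<sigma>) ^ (k + 2) \<le> 1 * 1"
    using assms by (intro mult_mono power_le_one) auto
  then show ?thesis using assms by (simp add: bump_def)
qed

text \<open>A bound uniform in k, for dominated convergence. With z = 1 - \<sigma>, each of the k +
  2 copies of z^(k+1) is at most the matching term z^i of the geometric sum, so the subtracted term
  lies between 0 and 1 - z^(k+2).\<close>

lemma bump_deriv_bound: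
  assumes "0 \<le> \<sigma>" "\<sigma> \<le> 1"
  shows "\<bar>bump_deriv k \<sigma>\<bar> \<le> 1"
proof -
  define z where "z = 1 - \<sigma>"
  have z: "0 \<le> z" "z \<le> 1" using assms by (auto simp: z_def)
  have "real (k + 2) * z ^ (k + 1) = (\<Sum>i<k + 2. z ^ (k + 1))" by simp
  also have "\<dots> \<le> (\<Sum>i<k + 2. z ^ i)"
    by (intro sum_mono power_decreasing) (use z in auto)
  finally have "(1 - z) * (real (k + 2) * z ^ (k + 1)) \<le> (1 - z) * (\<Sum>i<k + 2. z ^ i)"
    using z by (intro mult_left_mono) auto
  also have "\<dots> = 1 - z ^ (k + 2)" by (rule one_diff_power_eq[symmetric])
  finally have "real (k + 2) * \<sigma> * z ^ (k + 1) \<le> 1 - z ^ (k + 2)"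
    by (simp add: z_def mult_ac)
  moreover have "0 \<le> real (k + 2) * \<sigma> * z ^ (k + 1)" "0 \<le> z ^ (k + 2)" "z ^ (k + 2) \<le> 1"
    using z assms power_le_one[OF z, of "k + 2"] by simp_all
  ultimately show ?thesis
    unfolding bump_deriv_def z_def[symmetric] by linarith
qed

text \<open>Geometric decay beats the factor k + 2. The derivative equals 1 at \<sigma> = 0 for
  every k, hence the restriction to the open interval.\<close>

lemma bump_tendsto:
  assumes "0 < \<sigma>" "\<sigma> < 1"
  shows "(\<lambda>k. bump k \<sigma>) \<longlonglongrightarrow> 0" and "(\<lambda>k. bump_deriv k \<sigma>) \<longlonglongrightarrow> 0"
proof -
  define z where "z = 1 - \<sigma>"
  have z: "0 < z" "z < 1" using assms by (auto simp: z_def)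
  have pow: "(\<lambda>k. z ^ (k + m)) \<longlonglongrightarrow> 0" for m
    using LIMSEQ_ignore_initial_segment[OF LIMSEQ_realpow_zero[of z], of m] z by simp
  have "(\<lambda>k. \<sigma> * z ^ (k + 2)) \<longlonglongrightarrow> \<sigma> * 0" by (intro tendsto_mult_left pow)
  then show "(\<lambda>k. bump k \<sigma>) \<longlonglongrightarrow> 0" by (simp add: bump_def z_def)
  have "(\<lambda>k. real (k + 1) * z ^ (k + 1)) \<longlonglongrightarrow> 0"
    using LIMSEQ_ignore_initial_segment[OF powser_times_n_limit_0[of z], of 1] z by simp
  then have "(\<lambda>k. z ^ (k + 2) - \<sigma> * (real (k + 1) * z ^ (k + 1) + z ^ (k + 1))) \<longlonglongrightarrow> 0 - \<sigma> * (0 + 0)"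
    by (intro tendsto_intros pow)
  moreover have "z ^ (k + 2) - \<sigma> * (real (k + 1) * z ^ (k + 1) + z ^ (k + 1)) = bump_deriv k \<sigma>" for k
    by (simp add: bump_deriv_def z_def algebra_simps)
  ultimately show "(\<lambda>k. bump_deriv k \<sigma>) \<longlonglongrightarrow> 0" by simp
qed

text \<open>Dominated convergence on the open interval, as bounds and limits are available only
  there.\<close>

lemma integral_norm_square_tendsto:
  fixes F :: "nat \<Rightarrow> real \<Rightarrow> complex"
  assumes cont: "\<And>k. continuous_on {u..v} (F k)"
    and bound: "\<And>k t. u < t \<Longrightarrow> t < v \<Longrightarrow> cmod (F k t) \<le> K"
    and lim: "\<And>t. u < t \<Longrightarrow> t < v \<Longrightarrow> (\<lambda>k. F k t) \<longlonglongrightarrow> G t"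
  shows "(\<lambda>k. integral {u..v} (\<lambda>t. (cmod (F k t))\<^sup>2)) \<longlonglongrightarrow> integral {u..v} (\<lambda>t. (cmod (G t))\<^sup>2)"
proof -
  have "(\<lambda>k. integral {u<..<v} (\<lambda>t. (cmod (F k t))\<^sup>2)) \<longlonglongrightarrow> integral {u<..<v} (\<lambda>t. (cmod (G t))\<^sup>2)"
  proof (rule dominated_convergence(2))
    show "(\<lambda>t. (cmod (F k t))\<^sup>2) integrable_on {u<..<v}" for k
      unfolding integrable_on_open_interval_real
      by (intro integrable_continuous_interval continuous_intros cont)
    show "(\<lambda>t. K\<^sup>2) integrable_on {u<..<v}"
      unfolding integrable_on_open_interval_real by (rule integrable_const_ivl)
    show "norm ((cmod (F k t))\<^sup>2) \<le> K\<^sup>2" if "t \<in> {u<..<v}" for k t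
      using power_mono[OF bound[of t k], of 2] that by simp
    show "(\<lambda>k. (cmod (F k t))\<^sup>2) \<longlonglongrightarrow> (cmod (G t))\<^sup>2" if "t \<in> {u<..<v}" for t
      using that by (intro tendsto_intros lim) auto
  qed
  then show ?thesis by (simp only: integral_open_interval_real)
qed

lemma hermite_poly_integral_tendsto:
  fixes a e p :: complex
  assumes L: "L > 0" and v: "v = u + L"
  shows "(\<lambda>k. integral {u..v} (\<lambda>t. (cmod (poly (hermite_poly u L a e p k) (of_real t)))\<^sup>2))
      \<longlonglongrightarrow> integral {u..v} (\<lambda>t. (cmod (a + e * of_real ((t - u) / L)))\<^sup>2)" (is ?val)
    and "(\<lambda>k. integral {u..v} (\<lambda>t. (cmod (poly (pderiv (hermite_poly u L a e p k)) (of_real t)))\<^sup>2))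
      \<longlonglongrightarrow> (cmod e)\<^sup>2 / L" (is ?der)
proof -
  have \<sigma>: "0 < (t - u) / L" "(t - u) / L < 1" if "u < t" "t < v" for t
    using that L v by (auto simp: field_simps)
  have bd: "cmod (z * of_real \<rho>) \<le> cmod z" if "\<bar>\<rho>\<bar> \<le> 1" for z \<rho>
    using mult_left_mono[OF that, of "cmod z"] by (simp add: norm_mult)
  show ?val
  proof (rule integral_norm_square_tendsto)
    show "continuous_on {u..v} (\<lambda>t. poly (hermite_poly u L a e p k) (of_real t))" for k
      by (intro continuous_intros)
    fix t assume t: "u < t" "t < v"
    note s = \<sigma>[OF t]
    show "cmod (poly (hermite_poly u L a e p k) (of_real t)) \<le> cmod a + cmod e + cmod (p - e) + cmod e" for k
      unfolding poly_hermite_poly[OF L] using s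
      by (intro norm_triangle_mono bd bump_bound order_refl) auto
    have "(\<lambda>k. a + e * of_real ((t - u) / L) + (p - e) * of_real (bump k ((t - u) / L))
       + e * of_real (bump k (1 - (t - u) / L))) \<longlonglongrightarrow> a + e * of_real ((t - u) / L) + (p - e) * of_real 0 + e * of_real 0"
      using s by (intro tendsto_intros bump_tendsto) auto
    then show "(\<lambda>k. poly (hermite_poly u L a e p k) (of_real t)) \<longlonglongrightarrow> a + e * of_real ((t - u) / L)"
      unfolding poly_hermite_poly[OF L] by simp
  qed
  have "(\<lambda>k. integral {u..v} (\<lambda>t. (cmod (poly (pderiv (hermite_poly u L a e p k)) (of_real t)))\<^sup>2))
      \<longlonglongrightarrow> integral {u..v} (\<lambda>t. (cmod (e / of_real L))\<^sup>2)"
  proof (rule integral_norm_square_tendsto)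
    show "continuous_on {u..v} (\<lambda>t. poly (pderiv (hermite_poly u L a e p k)) (of_real t))" for k
      by (intro continuous_intros)
    fix t assume t: "u < t" "t < v"
    note s = \<sigma>[OF t]
    show "cmod (poly (pderiv (hermite_poly u L a e p k)) (of_real t)) \<le> (cmod e + cmod (p - e) + cmod e) / L" for k
    proof -
      have "cmod (e + (p - e) * of_real (bump_deriv k ((t - u) / L)) - e * of_real (bump_deriv k (1 - (t - u) / L)))
          \<le> cmod e + cmod (p - e) + cmod e"
        using s by (intro order_trans[OF norm_triangle_ineq4] add_mono norm_triangle_mono bd bump_deriv_bound order_refl) auto
      then show ?thesis
        unfolding poly_pderiv_hermite_poly[OF L] norm_divide using L by (simp add: divide_right_mono)
    qed
    have "(\<lambda>k. (e + (p - e) * of_real (bump_deriv k ((t - u) / L)) - e * of_real (bump_deriv k (1 - (t - u) / L))) / of_real L)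
       \<longlonglongrightarrow> (e + (p - e) * of_real 0 - e * of_real 0) / of_real L"
      using s L by (intro tendsto_intros bump_tendsto) auto
    then show "(\<lambda>k. poly (pderiv (hermite_poly u L a e p k)) (of_real t)) \<longlonglongrightarrow> e / of_real L"
      unfolding poly_pderiv_hermite_poly[OF L] by simp
  qed
  moreover have "integral {u..v} (\<lambda>t. (cmod (e / of_real L))\<^sup>2) = (cmod e)\<^sup>2 / L"
    using L v by (simp add: norm_divide power_divide power2_eq_square)
  ultimately show ?der by simp
qed

text \<open>By convexity, |f| never exceeds the larger end value; this crude bound already matches
  the weights of \<open>graph_mass\<close>.\<close>

lemma integral_affine_bounds:
  fixes a c :: complex
  assumes L: "L > 0" and v: "v = u + L"
  shows "integral {u..v} (\<lambda>t. (cmod (a + (c - a) * of_real ((t - u) / L)))\<^sup>2) \<le> L * ((cmod a)\<^sup>2 + (cmod c)\<^sup>2)"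
    and "0 \<le> integral {u..v} (\<lambda>t. (cmod (a + (c - a) * of_real ((t - u) / L)))\<^sup>2)"
proof -
  let ?h = "\<lambda>t. (cmod (a + (c - a) * of_real ((t - u) / L)))\<^sup>2"
  have int: "?h integrable_on {u..v}"
    using L by (intro integrable_continuous_interval continuous_intros) auto
  then show "0 \<le> integral {u..v} ?h"
    by (rule Henstock_Kurzweil_Integration.integral_nonneg) simp
  have "?h t \<le> (cmod a)\<^sup>2 + (cmod c)\<^sup>2" if "t \<in> {u..v}" for t
  proof -
    define \<sigma> where "\<sigma> = (t - u) / L"
    have \<sigma>: "0 \<le> \<sigma>" "\<sigma> \<le> 1" using that L v by (auto simp: \<sigma>_def field_simps)
    have "a + (c - a) * of_real \<sigma> = a * of_real (1 - \<sigma>) + c * of_real \<sigma>" by (simp add: algebra_simps)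
    then have "cmod (a + (c - a) * of_real \<sigma>) \<le> cmod a * (1 - \<sigma>) + cmod c * \<sigma>"
      using norm_triangle_ineq[of "a * of_real (1 - \<sigma>)" "c * of_real \<sigma>"] \<sigma> by (simp add: norm_mult del: of_real_diff)
    also have "\<dots> \<le> max (cmod a) (cmod c) * (1 - \<sigma>) + max (cmod a) (cmod c) * \<sigma>"
      using \<sigma> by (intro add_mono mult_right_mono) auto
    also have "\<dots> = max (cmod a) (cmod c)" by (simp add: algebra_simps)
    finally have "?h t \<le> (max (cmod a) (cmod c))\<^sup>2"
      unfolding \<sigma>_def by (intro power_mono) auto
    also have "\<dots> \<le> (cmod a)\<^sup>2 + (cmod c)\<^sup>2" by (simp add: max_def)
    finally show ?thesis .
  qed
  then have "integral {u..v} ?h \<le> integral {u..v} (\<lambda>t. (cmod a)\<^sup>2 + (cmod c)\<^sup>2)"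
    by (intro integral_le int integrable_const_ivl)
  then show "integral {u..v} ?h \<le> L * ((cmod a)\<^sup>2 + (cmod c)\<^sup>2)"
    using L v by simp
qed

section \<open>Test functions: from the Hamiltonian back to the graph form\<close>

context node_sequence
begin

lemma piecewise_zero:
  assumes "\<And>n. n \<ge> N \<Longrightarrow> Q n = 0" "t \<in> I" "x N < t"
  shows "piecewise Q t = 0"
proof -
  obtain n where n: "x n \<le> t" "t < x (n + 1)" using assms(2) by (rule interval_cover)
  then have "x N < x (n + 1)" using assms(3) by simp
  then have "n \<ge> N" using strict_mono_less[OF strict_mono_x] by simp
  then show ?thesis using assms(1) by (simp add: piecewise_eq[OF n])
qed

lemma H_semibounded_imp_graph_form_bounded:
  assumes d: "\<And>n. n \<ge> 1 \<Longrightarrow> d n = x n - x (n - 1)"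
    and "lower_semibounded (lebesgue_on I) (H_op b x \<alpha>)"
  shows "graph_form_bounded d \<alpha>"
proof -
  obtain c where c: "\<And>f. f \<in> H_dom b x \<alpha> \<Longrightarrow>
      c * (L2_norm (lebesgue_on I) f)\<^sup>2 \<le> Re (L2_inner (lebesgue_on I) (\<lambda>t. - D1 (D1 f) t) f)"
    using assms(2) unfolding H_op_semibounded_iff by blast
  have d_Suc: "d (n + 1) = x (n + 1) - x n" for n using d[of "n + 1"] by simp
  have d_pos: "d (n + 1) > 0" for n using x_Suc[of n] d_Suc[of n] by linarith
  have x_eq: "x (n + 1) = x n + d (n + 1)" for n using d_Suc[of n] by linarith
  have main: "- \<bar>c\<bar> * graph_mass d N y \<le> graph_form d \<alpha> N y"
    if "N \<ge> 1" and y_N: "\<And>n. n \<ge> N \<Longrightarrow> y n = 0" for y N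
  proof -
    define e where "e n = y (n + 1) - y n" for n
    \<comment> \<open>The left end slope is to be \<alpha>_n y_n, or 0 at the origin; the factor
      d_(n+1) converts it to the scaled variable. As all right end slopes are 0, this is the whole
      jump.\<close>
    define p where "p n = (if n = 0 then 0 else of_real (\<alpha> n) * y n) * of_real (d (n + 1))" for n
    define Q where "Q k n = hermite_poly (x n) (d (n + 1)) (y n) (e n) (p n) k" for k n
    define E where "E k n = integral {x n..x (n + 1)} (\<lambda>t. (cmod (poly (pderiv (Q k n)) (of_real t)))\<^sup>2)" for k n
    define F where "F k n = integral {x n..x (n + 1)} (\<lambda>t. (cmod (poly (Q k n) (of_real t)))\<^sup>2)" for k n
    define F0 where "F0 n = integral {x n..x (n + 1)} (\<lambda>t. (cmod (y n + e n * of_real ((t - x n) / d (n + 1))))\<^sup>2)" for n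
    have ends: "poly (Q k n) (of_real (x n)) = y n" "poly (Q k n) (of_real (x (n + 1))) = y (n + 1)"
      "poly (pderiv (Q k n)) (of_real (x n)) = (if n = 0 then 0 else of_real (\<alpha> n) * y n)"
      "poly (pderiv (Q k n)) (of_real (x (n + 1))) = 0" for k n
    proof -
      have 1: "(x (n + 1) - x n) / d (n + 1) = 1" using d_pos[of n] by (simp only: d_Suc) simp
      note pd = d_pos[of n]
      show "poly (Q k n) (of_real (x n)) = y n"
        unfolding Q_def poly_hermite_poly[OF pd] by (simp add: bump_def)
      show "poly (Q k n) (of_real (x (n + 1))) = y (n + 1)"
        unfolding Q_def poly_hermite_poly[OF pd] 1 by (simp add: bump_def e_def)
      show "poly (pderiv (Q k n)) (of_real (x n)) = (if n = 0 then 0 else of_real (\<alpha> n) * y n)"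
        unfolding Q_def poly_pderiv_hermite_poly[OF pd] using pd by (simp add: bump_deriv_def p_def)
      show "poly (pderiv (Q k n)) (of_real (x (n + 1))) = 0"
        unfolding Q_def poly_pderiv_hermite_poly[OF pd] 1 by (simp add: bump_deriv_def)
    qed
    have Q0: "Q k n = 0" if "n \<ge> N" for k n
      using that y_N[of n] y_N[of "n + 1"] by (simp add: Q_def hermite_poly_def e_def p_def)
    have key: "c * (\<Sum>n<N. F k n) \<le> (\<Sum>n<N. E k n) + (\<Sum>n=1..<N. \<alpha> n * (cmod (y n))\<^sup>2)" for k
    proof -
      let ?f = "piecewise (Q k)"
      have dom: "?f \<in> H_dom b x \<alpha>"
      proof (rule piecewise_in_H_dom[of N])
        show "poly (pderiv (Q k 0)) 0 = 0" using ends(3)[of k 0] x_0 by simp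
      qed (use Q0 ends[of k] in simp_all)
      have supp: "\<forall>t\<in>I - X. x N < t \<longrightarrow> ?f t = 0"
        using piecewise_zero[of N "Q k"] Q0 by simp
      obtain z where "\<And>n. n \<ge> N \<Longrightarrow> z n = 0"
        and z: "\<And>n. n \<ge> 1 \<Longrightarrow> (?f \<longlongrightarrow> z n) (at_right (x n))"
        and inner: "L2_inner (lebesgue_on I) (\<lambda>t. - D1 (D1 ?f) t) ?f = of_real
          ((\<Sum>n<N. integral {x n..x (n + 1)} (\<lambda>t. (cmod (D1 ?f t))\<^sup>2)) + (\<Sum>n=1..<N. \<alpha> n * (cmod (z n))\<^sup>2))"
        and norm: "(L2_norm (lebesgue_on I) ?f)\<^sup>2 = (\<Sum>n<N. integral {x n..x (n + 1)} (\<lambda>t. (cmod (?f t))\<^sup>2))"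
        by (rule H_dom_form[OF dom \<open>N \<ge> 1\<close> supp]) blast
      \<comment> \<open>Green's formula yields only some trace \<open>z\<close>; uniqueness of right
        limits identifies it with the prescribed values.\<close>
      have "z n = y n" if "n \<ge> 1" for n
        using tendsto_unique[OF trivial_limit_at_right_real z[OF that] piecewise_limits(1)[OF refl, of "Q k" n]]
          ends(1)[of k n] by simp
      moreover have "integral {x n..x (n + 1)} (\<lambda>t. (cmod (?f t))\<^sup>2) = F k n" for n
        unfolding F_def by (rule integral_spike_Icc) (simp add: piecewise_eq[OF less_imp_le])
      moreover have "integral {x n..x (n + 1)} (\<lambda>t. (cmod (D1 ?f t))\<^sup>2) = E k n" for n
        unfolding E_def
      proof (rule integral_spike_Icc)
        fix t assume t: "x n < t" "t < x (n + 1)"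
        have "t \<in> I - X" by (rule subsetD[OF interval_subset[of n]]) (use t in simp)
        from piecewise_deriv[OF refl this, of "Q k"]
        show "(cmod (D1 ?f t))\<^sup>2 = (cmod (poly (pderiv (Q k n)) (of_real t)))\<^sup>2"
          using t by (simp add: piecewise_eq[OF less_imp_le])
      qed
      ultimately show ?thesis
        using c[OF dom] unfolding inner norm by simp
    qed
    have limF: "(\<lambda>k. F k n) \<longlonglongrightarrow> F0 n" for n
      unfolding F_def F0_def Q_def by (rule hermite_poly_integral_tendsto(1)[OF d_pos x_eq])
    have limE: "(\<lambda>k. E k n) \<longlonglongrightarrow> (cmod (e n))\<^sup>2 / d (n + 1)" for n
      unfolding E_def Q_def by (rule hermite_poly_integral_tendsto(2)[OF d_pos x_eq])
    have "c * (\<Sum>n<N. F0 n) \<le> (\<Sum>n<N. (cmod (e n))\<^sup>2 / d (n + 1)) + (\<Sum>n=1..<N. \<alpha> n * (cmod (y n))\<^sup>2)"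
    proof (rule LIMSEQ_le)
      show "(\<lambda>k. c * (\<Sum>n<N. F k n)) \<longlonglongrightarrow> c * (\<Sum>n<N. F0 n)"
        by (intro tendsto_intros limF)
      show "(\<lambda>k. (\<Sum>n<N. E k n) + (\<Sum>n=1..<N. \<alpha> n * (cmod (y n))\<^sup>2)) \<longlonglongrightarrow>
          (\<Sum>n<N. (cmod (e n))\<^sup>2 / d (n + 1)) + (\<Sum>n=1..<N. \<alpha> n * (cmod (y n))\<^sup>2)"
        by (intro tendsto_intros limE)
    qed (use key in blast)
    also have "\<dots> = graph_form d \<alpha> N y" by (simp add: graph_form_def e_def)
    finally have 1: "c * (\<Sum>n<N. F0 n) \<le> graph_form d \<alpha> N y" .
    \<comment> \<open>An upper bound for the norm can be inserted only with a nonpositive constant,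
      hence \<open>- \<bar>c\<bar>\<close> in place of \<open>c\<close>.\<close>
    have "(\<Sum>n<N. F0 n) \<le> graph_mass d N y"
      unfolding graph_mass_def F0_def e_def
      by (intro sum_mono integral_affine_bounds(1)[OF d_pos x_eq])
    then have "\<bar>c\<bar> * (\<Sum>n<N. F0 n) \<le> \<bar>c\<bar> * graph_mass d N y"
      by (intro mult_left_mono) auto
    moreover have "0 \<le> (\<Sum>n<N. F0 n)"
      unfolding F0_def e_def by (intro sum_nonneg integral_affine_bounds(2)[OF d_pos x_eq])
    then have "- \<bar>c\<bar> * (\<Sum>n<N. F0 n) \<le> c * (\<Sum>n<N. F0 n)"
      by (intro mult_right_mono) auto
    ultimately show ?thesis using 1 by linarith
  qed
  have "- \<bar>c\<bar> * graph_mass d N y \<le> graph_form d \<alpha> N y" if "\<forall>n\<ge>N. y n = 0" for y N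
  \<comment> \<open>\<open>H_dom_form\<close> requires N \<ge> 1; for N = 0 all sums are
    empty.\<close>
  proof (cases "N = 0")
    case True
    then show ?thesis by (simp add: graph_mass_def graph_form_def)
  next
    case False
    then show ?thesis using main[of N y] that by simp
  qed
  then show ?thesis unfolding graph_form_bounded_def by blast
qed

end

theorem theorem5p24:
  fixes b :: ereal and x d r \<alpha> :: "nat \<Rightarrow> real"
  assumes "0 < b"
    and "x 0 = 0" and "strict_mono x" and "\<And>n. ereal (x n) < b"
    and "(\<lambda>n. ereal (x n)) \<longlonglongrightarrow> b"
    and d: "\<And>n. n \<ge> 1 \<Longrightarrow> d n = x n - x (n - 1)"
    and "bdd_above (d ` {1..})"
    and r: "\<And>n. n \<ge> 1 \<Longrightarrow> r n = sqrt (d n + d (n + 1))"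
  shows "lower_semibounded (lebesgue_on (half_open b)) (H_op b x \<alpha>) \<longleftrightarrow>
    lower_semibounded (count_space {1..})
      (min_jacobi_op
        (\<lambda>n. 1 / (r n)\<^sup>2 * (\<alpha> n + 1 / d n + 1 / d (n + 1)))
        (\<lambda>n. - (1 / (r n * r (n + 1) * d (n + 1)))))"
proof -
  interpret node_sequence b x
    using assms(2-5) by unfold_locales
  have d_pos: "d n > 0" if "n \<ge> 1" for n
    using strict_monoD[OF assms(3), of "n - 1" n] d[OF that] that by simp
  have "lower_semibounded (lebesgue_on (half_open b)) (H_op b x \<alpha>) \<longleftrightarrow> graph_form_bounded d \<alpha>"
    using H_semibounded_imp_graph_form_bounded[of d \<alpha>, OF d]
      graph_form_bounded_imp_H_semibounded[of d \<alpha>, OF d assms(7)] by blast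
  also have "\<dots> \<longleftrightarrow> lower_semibounded (count_space {1..})
      (min_jacobi_op
        (\<lambda>n. 1 / (r n)\<^sup>2 * (\<alpha> n + 1 / d n + 1 / d (n + 1)))
        (\<lambda>n. - (1 / (r n * r (n + 1) * d (n + 1)))))"
    by (rule min_jacobi_op_semibounded_iff[of d r \<alpha>, OF d_pos r, symmetric])
  finally show ?thesis .
qed

end
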